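(* Let $q \ge 2$ be an integer, let $C_q$ be the cyclic group of order $q$, and let $$\theta = \min_{\beta>0}\,(1+\beta+\cdots+\beta^{q-1})\,\beta^{-(q-1)/3}.$$ Then there exist constants $K$ and $N$, depending only on $q$, such that for every integer $n \ge N$ there is a sum-free set in $C_q^n$ (with some target $\mathbf{t}\in C_q^n$) whose size is at least $$\theta^n \, e^{-2\sqrt{(2\log 2\,\log\theta)\,n}\; -\; K\log n}.$$
   Context: All logarithms are to base $e$. For a finite abelian group $G$, a positive integer $n$ and $\mathbf{t}\in G^n$, a sum-free set in $G^n$ with target $\mathbf{t}$ is a collection of triples $(\mathbf{a}_i,\mathbf{b}_i,\mathbf{c}_i)\in G^n\times G^n\times G^n$, indexed by $i$ in a finite index set, such that for all indices $i,j,k$ one has $\mathbf{a}_i+\mathbf{b}_j+\mathbf{c}_k=\mathbf{t}$ if and only if $i=j=k$. (This is usually called a tri-colored sum-free set. Replacing each $(\mathbf{a}_i,\mathbf{b}_i,\mathbf{c}_i)$ by $(\mathbf{a}_i,\mathbf{b}_i,\mathbf{c}_i-\mathbf{t})$ makes the target $\mathbf{0}$.) The size of a sum-free set is its number of triples. *)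

theory Defs
  imports Complex_Main "HOL-Algebra.Product_Groups"
begin

text \<open>
  The power \<open>G\<^sup>n\<close> is the product group indexed by \<open>{..<n}\<close>; its elements are extensional functions.
\<close>

abbreviation power_group :: "('g, 'm) monoid_scheme \<Rightarrow> nat \<Rightarrow> (nat \<Rightarrow> 'g) monoid" where
  "power_group G n \<equiv> product_group {..<n} (\<lambda>_. G)"

text \<open>
  Groups are written multiplicatively in the algebra library, so the equation
  \<open>a\<^sub>i + b\<^sub>j + c\<^sub>k = t\<close> reads \<open>a i \<otimes> b j \<otimes> c k = t\<close>. The size of the
  sum-free set is \<open>card I\<close>; the defining condition forces the triples to be distinct.
\<close>

definition sum_free_set ::
  "('g, 'm) monoid_scheme \<Rightarrow> nat \<Rightarrow> (nat \<Rightarrow> 'g) \<Rightarrow> 'i set \<Rightarrow>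
    ('i \<Rightarrow> nat \<Rightarrow> 'g) \<Rightarrow> ('i \<Rightarrow> nat \<Rightarrow> 'g) \<Rightarrow> ('i \<Rightarrow> nat \<Rightarrow> 'g) \<Rightarrow> bool" where
  "sum_free_set G n t I a b c \<longleftrightarrow>
     comm_group G \<and> finite (carrier G) \<and> t \<in> carrier (power_group G n) \<and> finite I \<and>
     (\<forall>i\<in>I. a i \<in> carrier (power_group G n) \<and> b i \<in> carrier (power_group G n) \<and>
            c i \<in> carrier (power_group G n)) \<and>
     (\<forall>i\<in>I. \<forall>j\<in>I. \<forall>k\<in>I.
        a i \<otimes>\<^bsub>power_group G n\<^esub> b j \<otimes>\<^bsub>power_group G n\<^esub> c k = t \<longleftrightarrow> i = j \<and> j = k)"

definition theta_fun :: "nat \<Rightarrow> real \<Rightarrow> real" where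
  "theta_fun q \<beta> = (\<Sum>j<q. \<beta> ^ j) * \<beta> powr (- ((real q - 1) / 3))"

text \<open>
  For a set of reals, \<open>LEAST\<close> denotes the minimum provided that it is attained; the lemma
  below shows that it is for \<open>q \<ge> 2\<close>.
\<close>

definition theta :: "nat \<Rightarrow> real" where
  "theta q = (LEAST y. y \<in> theta_fun q ` {0<..})"

lemma theta_attained:
  assumes "q \<ge> 2"
  shows "\<exists>\<beta>>0. theta q = theta_fun q \<beta> \<and> (\<forall>\<gamma>>0. theta_fun q \<beta> \<le> theta_fun q \<gamma>)"
proof -
  define s where "s = (real q - 1) / 3"
  have s: "s > 0" using assms by (simp add: s_def)
  define l where "l = real q powr (- 1 / s)"
  define u where "u = real q powr (1 / (2 * s))"
  have q1: "real q \<ge> 1" using assms by simp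
  have l0: "l > 0" using assms by (simp add: l_def)
  have l1: "l \<le> 1" unfolding l_def using q1 s powr_mono[of "- 1 / s" 0 "real q"] by simp
  have u1: "1 \<le> u" unfolding u_def using q1 s by (simp add: ge_one_powr_ge_zero)
  have f1: "theta_fun q 1 = real q" by (simp add: theta_fun_def)
  have cont: "continuous_on {l..u} (theta_fun q)"
    unfolding theta_fun_def using l0 by (auto intro!: continuous_intros)
  have "\<exists>x\<in>{l..u}. \<forall>y\<in>{l..u}. theta_fun q x \<le> theta_fun q y"
    by (rule continuous_attains_inf) (use cont l1 u1 in auto)
  then obtain x where x: "x \<in> {l..u}" and xmin: "\<And>y. y \<in> {l..u} \<Longrightarrow> theta_fun q x \<le> theta_fun q y"
    by blast
  have xq: "theta_fun q x \<le> real q" using xmin[of 1] l1 u1 f1 by simp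
  have small: "real q \<le> theta_fun q y" if y: "0 < y" "y < l" for y
  proof -
    have "real q = l powr (- s)" unfolding l_def using s assms by (simp add: powr_powr)
    also have "\<dots> \<le> y powr (- s)" by (rule powr_mono2') (use y s in auto)
    also have "\<dots> = y ^ 0 * y powr (- s)" by simp
    also have "\<dots> \<le> (\<Sum>j<q. y ^ j) * y powr (- s)"
      by (intro mult_right_mono member_le_sum) (use y assms in auto)
    finally show ?thesis by (simp add: theta_fun_def s_def)
  qed
  have large: "real q \<le> theta_fun q y" if y: "y > u" for y
  proof -
    have y0: "y > 0" using y u1 by simp
    have "real q = u powr (2 * s)" unfolding u_def using s assms by (simp add: powr_powr)
    also have "\<dots> \<le> y powr (2 * s)" by (rule powr_mono2) (use y s u1 in auto)
    also have "2 * s = real (q - 1) + (- s)" using assms by (simp add: s_def of_nat_diff field_simps)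
    also have "y powr (real (q - 1) + (- s)) = y ^ (q - 1) * y powr (- s)"
      using y0 by (simp only: powr_add powr_realpow)
    also have "\<dots> \<le> (\<Sum>j<q. y ^ j) * y powr (- s)"
      by (intro mult_right_mono member_le_sum) (use y0 assms in auto)
    finally show ?thesis by (simp add: theta_fun_def s_def)
  qed
  have x0: "x > 0" using x l0 by simp
  have min: "theta_fun q x \<le> theta_fun q y" if "y > 0" for y
    using small[of y] large[of y] xmin[of y] xq that by force
  have "theta q = theta_fun q x"
    unfolding theta_def by (rule Least_equality) (use x0 min in auto)
  with x0 min show ?thesis by blast
qed

end

theory Submission
  imports Defs "HOL-Combinatorics.Multiset_Permutations" "HOL-Number_Theory.Cong"
    "HOL-Real_Asymp.Real_Asymp"
begin

text \<open>
  Write \<open>N = q - 1\<close>. The minimiser \<open>\<beta>\<close> in the definition of \<open>theta q\<close> satisfies \<open>\<beta> \<le> 1\<close>, and the law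
  \<open>p j \<propto> \<beta> ^ j\<close> on \<open>{..N}\<close> has mean \<open>N / 3\<close> (lemma \<open>theta_minimiser\<close>). A word of length \<open>n\<close> over
  \<open>{..N}\<close> with entries summing to \<open>n * N / 3\<close> has probability exactly \<open>theta q ^ (- n)\<close> under \<open>p\<close>, so
  there are at most \<open>theta q ^ n\<close> such words, and suitable rearrangement classes of them (types)
  attain this up to a factor polynomial in \<open>n\<close>.

  The first half of the proof finds a type \<open>M\<close> of this size such that some three words \<open>a\<close>, \<open>b\<close>, \<open>c\<close> of
  type \<open>M\<close> satisfy \<open>a + b + c = N\<close> in every position. This needs three random variables, each with law
  \<open>p\<close>, whose sum is constantly \<open>N\<close>. They exist for every nonincreasing law with mean \<open>N / 3\<close> (lemma
  \<open>decreasing_coupling\<close>). By Farkas' lemma the claim is dual to an inequality: if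
  \<open>F x + F y + F z \<ge> 0\<close> whenever \<open>x + y + z = N\<close>, then \<open>\<Sum>x. p x * F x \<ge> 0\<close>. Adding a multiple of
  \<open>3 * x - N\<close> to \<open>F\<close> changes neither the hypothesis nor the conclusion, and a suitable multiple makes
  all prefix sums of \<open>F\<close> nonnegative (lemma \<open>tilt_to_nonneg_prefix_sums\<close>); summation by parts does
  the rest. To see that the best multiple works, suppose that it does not: then two prefixes
  \<open>{..m1}\<close> and \<open>{..m2}\<close> attain the same negative least average, so that all their suffixes have averages
  that are at most as large, and explicit families of triples with sum \<open>N\<close>, spread over such suffixes,
  contain one with negative \<open>F\<close>-sum (lemma \<open>tight_prefix_triple\<close>). Given the three variables, the union
  bound over the polynomially many types shows that a random word of triples has three heavy types, and
  joining the word to its two cyclic rotations makes the three types equal (lemma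
  \<open>exists_heavy_symmetric_type\<close>).

  The second half turns the many triples of words of type \<open>M\<close> into a sum-free set, by the method of
  Salem--Spencer, Behrend and Coppersmith--Winograd. Let \<open>W\<close> be the number of words of type \<open>M\<close>; by
  symmetry each of them lies in the same number \<open>D \<le> W\<close> of triples. Random affine maps modulo some \<open>P\<close>
  of order \<open>D\<close> send the members of a triple to \<open>x\<close>, \<open>y\<close>, \<open>z\<close> with \<open>x + y = 2 * z\<close>. Keep the triples with all
  three hash values in a set \<open>S\<close> without three-term progressions: their three hash values agree, a
  given triple survives with probability \<open>card S / P\<^sup>2\<close>, and two triples sharing a word both survive
  with probability \<open>card S / P ^ 3\<close> only. Hence on the order of \<open>W * D * card S / P\<^sup>2\<close> triples survive without
  sharing a word with another survivor, and these form a sum-free set (lemma \<open>hash_selection\<close>): three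
  words of survivors that add up to \<open>N\<close> modulo \<open>q\<close> add up to exactly \<open>N\<close>, because types fix the total of
  all entries, so they form a surviving triple themselves. Behrend's sets (lemma \<open>behrend\<close>) have
  \<open>card S / P\<close> at least of order \<open>exp (- 2 * sqrt (2 * ln 2 * ln P))\<close> up to a factor polynomial in \<open>ln P\<close>, and
  \<open>ln P \<le> n * ln (theta q) + O(1)\<close>; this is where the error term comes from.
\<close>

section \<open>Farkas' lemma\<close>

text \<open>
  Induction on the number of generators. If the generators \<open>v t\<close> for
  \<open>t \<in> T\<close> do not suffice, some functional \<open>F\<close> is nonnegative on them and negative on \<open>b\<close>, hence negative on
  the new generator \<open>v s\<close>. Projecting along \<open>v s\<close> onto the kernel of \<open>F\<close> reduces the claim to \<open>T\<close>.
\<close>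
lemma farkas:
  fixes v :: "'t \<Rightarrow> 'j \<Rightarrow> real" and b :: "'j \<Rightarrow> real"
  assumes "finite T" "finite J"
    and "\<And>F. (\<And>t. t \<in> T \<Longrightarrow> 0 \<le> (\<Sum>j\<in>J. F j * v t j)) \<Longrightarrow> 0 \<le> (\<Sum>j\<in>J. F j * b j)"
  shows "\<exists>w. (\<forall>t\<in>T. 0 \<le> w t) \<and> (\<forall>j\<in>J. b j = (\<Sum>t\<in>T. w t * v t j))"
  using assms(1,3)
proof (induction T arbitrary: v b rule: finite_induct)
  case empty
  have "0 \<le> (\<Sum>j\<in>J. - b j * b j)"
    by (rule empty) simp
  then have "(\<Sum>j\<in>J. b j * b j) \<le> 0"
    by (simp add: sum_negf)
  moreover have "(\<Sum>j\<in>J. b j * b j) \<ge> 0"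
    by (simp add: sum_nonneg)
  ultimately have "(\<Sum>j\<in>J. b j * b j) = 0"
    by linarith
  then have "\<forall>j\<in>J. b j * b j = 0"
    using assms(2) by (subst (asm) sum_nonneg_eq_0_iff) auto
  then show ?case by simp
next
  case (insert s T)
  show ?case
  proof (cases "\<forall>F. (\<forall>t\<in>T. 0 \<le> (\<Sum>j\<in>J. F j * v t j)) \<longrightarrow> 0 \<le> (\<Sum>j\<in>J. F j * b j)")
    case True
    then obtain w where w: "\<forall>t\<in>T. 0 \<le> w t" "\<forall>j\<in>J. b j = (\<Sum>t\<in>T. w t * v t j)"
      using insert.IH[of v b] by blast
    have "\<forall>j\<in>J. b j = (\<Sum>t\<in>insert s T. (w(s := 0)) t * v t j)"
      using w(2) insert.hyps by (auto intro!: sum.cong)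
    then show ?thesis
      using w(1) by (intro exI[of _ "w(s := 0)"]) auto
  next
    case False
    then obtain F where F: "\<And>t. t \<in> T \<Longrightarrow> 0 \<le> (\<Sum>j\<in>J. F j * v t j)" "(\<Sum>j\<in>J. F j * b j) < 0"
      by force
    define f where "f x = (\<Sum>j\<in>J. F j * x j)" for x :: "'j \<Rightarrow> real"
    define z where "z = f (v s)"
    have z: "z < 0"
    proof (rule ccontr)
      assume "\<not> z < 0"
      then have "0 \<le> (\<Sum>j\<in>J. F j * b j)"
        using F(1) by (intro insert.prems) (auto simp: z_def f_def)
      then show False using F(2) by simp
    qed
    define pr where "pr x j = x j - f x / z * v s j" for x j
    \<comment> \<open>the dual of the projection: correcting \<open>G\<close> by a multiple of \<open>F\<close> that makes it vanish
      at \<open>v s\<close> amounts to composing it with the projection\<close>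
    have dual: "(\<Sum>j\<in>J. (G j - (\<Sum>j\<in>J. G j * v s j) / z * F j) * x j) = (\<Sum>j\<in>J. G j * pr x j)" for G x
    proof -
      have "(\<Sum>j\<in>J. (G j - (\<Sum>j\<in>J. G j * v s j) / z * F j) * x j)
          = (\<Sum>j\<in>J. G j * x j) - (\<Sum>j\<in>J. G j * v s j) / z * f x"
        unfolding f_def sum_distrib_left sum_subtractf[symmetric]
        by (intro sum.cong refl) (simp add: algebra_simps)
      also have "\<dots> = (\<Sum>j\<in>J. G j * x j) - f x / z * (\<Sum>j\<in>J. G j * v s j)"
        by simp
      also have "\<dots> = (\<Sum>j\<in>J. G j * pr x j)"
        unfolding pr_def sum_distrib_left sum_subtractf[symmetric]
        by (intro sum.cong refl) (simp add: algebra_simps)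
      finally show ?thesis .
    qed
    have "\<exists>w. (\<forall>t\<in>T. 0 \<le> w t) \<and> (\<forall>j\<in>J. pr b j = (\<Sum>t\<in>T. w t * pr (v t) j))"
    proof (rule insert.IH)
      fix G assume G: "\<And>t. t \<in> T \<Longrightarrow> 0 \<le> (\<Sum>j\<in>J. G j * pr (v t) j)"
      have s0: "(\<Sum>j\<in>J. G j * pr (v s) j) = 0"
        using z by (simp add: pr_def z_def)
      have "0 \<le> (\<Sum>j\<in>J. (G j - (\<Sum>j\<in>J. G j * v s j) / z * F j) * b j)"
        by (rule insert.prems) (use G s0 in \<open>unfold dual, auto\<close>)
      then show "0 \<le> (\<Sum>j\<in>J. G j * pr b j)" by (simp only: dual)
    qed
    then obtain w where w: "\<forall>t\<in>T. 0 \<le> w t" "\<forall>j\<in>J. pr b j = (\<Sum>t\<in>T. w t * pr (v t) j)"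
      by blast
    define c where "c = f b / z - (\<Sum>t\<in>T. w t * f (v t)) / z"
    have "(\<Sum>t\<in>T. w t * f (v t)) \<ge> 0"
      using w(1) F(1) by (intro sum_nonneg) (auto simp: f_def)
    moreover have "f b < 0" using F(2) by (simp add: f_def)
    ultimately have c: "c \<ge> 0"
      using z by (simp add: c_def diff_divide_distrib[symmetric] divide_nonpos_neg)
    have "b j = c * v s j + (\<Sum>t\<in>T. w t * v t j)" if "j \<in> J" for j
    proof -
      have "b j - f b / z * v s j = (\<Sum>t\<in>T. w t * v t j) - (\<Sum>t\<in>T. w t * f (v t)) / z * v s j"
        using w(2) that by (simp add: pr_def algebra_simps sum_subtractf sum_distrib_left
            sum_distrib_right flip: sum_divide_distrib)
      then show ?thesis by (simp add: c_def algebra_simps)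
    qed
    then have "\<forall>j\<in>J. b j = (\<Sum>t\<in>insert s T. (w(s := c)) t * v t j)"
      using insert.hyps by (auto intro!: sum.cong)
    then show ?thesis
      using w(1) c by (intro exI[of _ "w(s := c)"]) auto
  qed
qed


section \<open>Three summands with a given sum and prefix sums of one sign\<close>

text \<open>
  The triples \<open>(2a, j - a, 2j - a)\<close> for \<open>a \<le> j\<close> and \<open>(2a + 1, 2j - a, j - 1 - a)\<close> for \<open>a < j\<close> have sum \<open>3j\<close>, and
  each of their three entries runs through \<open>{..2j}\<close> exactly once. So the sum of \<open>Q\<close> over all of them is
  three times its sum over \<open>{..2j}\<close>.
\<close>
lemma equal_thirds_triple:
  fixes Q :: "nat \<Rightarrow> real"
  assumes "(\<Sum>x\<le>2*j. Q x) \<le> 0"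
  shows "\<exists>x y z. x + y + z = 3 * j \<and> x \<le> 2*j \<and> y \<le> 2*j \<and> z \<le> 2*j \<and> Q x + Q y + Q z \<le> 0"
proof (rule ccontr)
  assume neg: "\<not> ?thesis"
  have pos: "Q x + Q y + Q z > 0" if "x + y + z = 3 * j" "x \<le> 2*j" "y \<le> 2*j" "z \<le> 2*j" for x y z
    using neg that not_le by blast
  have even_odd: "(\<Sum>x\<le>2*j. Q x) = (\<Sum>a\<le>j. Q (2*a)) + (\<Sum>a<j. Q (2*a+1))"
    by (induction j) (simp_all add: lessThan_Suc algebra_simps)
  have split: "(\<Sum>x\<le>2*j. Q x) = (\<Sum>x<k. Q x) + (\<Sum>x\<in>{k..2*j}. Q x)" if "k \<le> 2 * j + 1" for k
    using that by (subst sum.union_disjoint[symmetric]) (auto intro!: sum.cong)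
  have low: "(\<Sum>a\<le>j. Q (j-a)) = (\<Sum>x<j+1. Q x)"
    by (rule sum.reindex_bij_witness[of _ "\<lambda>x. j - x" "\<lambda>a. j - a"]) auto
  have low': "(\<Sum>a<j. Q (j-1-a)) = (\<Sum>x<j. Q x)"
    by (rule sum.reindex_bij_witness[of _ "\<lambda>x. j - 1 - x" "\<lambda>a. j - 1 - a"]) auto
  have high: "(\<Sum>a\<le>j. Q (2*j-a)) = (\<Sum>x\<in>{j..2*j}. Q x)"
    by (rule sum.reindex_bij_witness[of _ "\<lambda>x. 2*j - x" "\<lambda>a. 2*j - a"]) auto
  have high': "(\<Sum>a<j. Q (2*j-a)) = (\<Sum>x\<in>{j+1..2*j}. Q x)"
    by (rule sum.reindex_bij_witness[of _ "\<lambda>x. 2*j - x" "\<lambda>a. 2*j - a"]) auto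
  have "0 < (\<Sum>a\<le>j. Q (2*a) + Q (j-a) + Q (2*j-a))"
    by (rule sum_pos) (auto intro!: pos)
  moreover have "0 \<le> (\<Sum>a<j. Q (2*a+1) + Q (2*j-a) + Q (j-1-a))"
    by (intro sum_nonneg less_imp_le[OF pos]) auto
  ultimately have "0 < 3 * (\<Sum>x\<le>2*j. Q x)"
    using even_odd split[of j] split[of "j+1"] low low' high high' by (simp add: sum.distrib)
  then show False using assms by simp
qed

text \<open>
  Raising one entry of a triple with sum \<open>n\<close> by one, the entry being chosen with probability
  proportional to its size, gives a random triple with sum \<open>n + 1\<close>. In the dual picture this replaces \<open>Q\<close>
  by \<open>Q' x = (1 - x / n) * Q x + (x / n) * Q (x + 1)\<close>, and as long as \<open>k + 1 \<le> n\<close> the sum of \<open>Q'\<close>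
  over \<open>{..k}\<close> is a nonnegative combination of prefix sums of \<open>Q\<close>.
\<close>
lemma size_biased_step:
  fixes Q :: "nat \<Rightarrow> real"
  assumes n: "n \<ge> 1" "M + 1 \<le> n" and Q: "\<And>k. k \<le> M + 1 \<Longrightarrow> (\<Sum>x\<le>k. Q x) \<le> 0"
    and step: "\<And>Q' :: nat \<Rightarrow> real. (\<And>k. k \<le> M \<Longrightarrow> (\<Sum>x\<le>k. Q' x) \<le> 0) \<Longrightarrow>
       \<exists>x y z. x + y + z = n \<and> x \<le> M \<and> y \<le> M \<and> z \<le> M \<and> Q' x + Q' y + Q' z \<le> 0"
  shows "\<exists>x y z. x + y + z = n + 1 \<and> x \<le> M + 1 \<and> y \<le> M + 1 \<and> z \<le> M + 1 \<and> Q x + Q y + Q z \<le> 0"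
proof -
  define Q' where "Q' x = (1 - x / n) * Q x + x / n * Q (x + 1)" for x :: nat
  have pre: "(\<Sum>x\<le>k. Q' x) = Q 0 / n + (1 - 1 / n - k / n) * (\<Sum>x\<le>k. Q x) + k / n * (\<Sum>x\<le>k+1. Q x)" for k
  proof (induction k)
    case 0
    show ?case using n by (simp add: Q'_def field_simps)
  next
    case (Suc k)
    have "(\<Sum>x\<le>Suc k. Q' x) = (\<Sum>x\<le>k. Q' x) + Q' (Suc k)" by simp
    also have "\<dots> = Q 0 / n + (1 - 1 / n - k / n) * (\<Sum>x\<le>k. Q x) + k / n * (\<Sum>x\<le>k+1. Q x) + Q' (Suc k)"
      by (simp only: Suc)
    also have "\<dots> = Q 0 / n + (1 - 1 / n - Suc k / n) * (\<Sum>x\<le>Suc k. Q x) + Suc k / n * (\<Sum>x\<le>Suc k+1. Q x)"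
      using n by (simp add: Q'_def field_simps)
    finally show ?case .
  qed
  have "(\<Sum>x\<le>k. Q' x) \<le> 0" if k: "k \<le> M" for k
  proof -
    have kn: "real k + 1 \<le> real n" using k n by linarith
    have "Q 0 / n \<le> 0" using Q[of 0] n by (simp add: divide_nonpos_pos)
    moreover
    have "1 / n + k / n \<le> 1" using n kn by (simp add: add_divide_distrib[symmetric])
    then have "1 - 1 / n - k / n \<ge> 0" by linarith
    then have "(1 - 1 / n - k / n) * (\<Sum>x\<le>k. Q x) \<le> 0"
      using Q[of k] k by (intro mult_nonneg_nonpos) auto
    moreover have "k / n * (\<Sum>x\<le>k+1. Q x) \<le> 0"
      using Q[of "k+1"] k by (intro mult_nonneg_nonpos) auto
    ultimately show ?thesis unfolding pre by linarith
  qed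
  from step[OF this] obtain x y z where xyz: "x + y + z = n" "x \<le> M" "y \<le> M" "z \<le> M" "Q' x + Q' y + Q' z \<le> 0"
    by blast
  have one: "x / n + y / n + z / n = (1::real)"
    using xyz(1) n by (simp add: field_simps flip: of_nat_add)
  have "Q' x + Q' y + Q' z = x / n * (Q (x+1) + Q y + Q z) + y / n * (Q x + Q (y+1) + Q z)
      + z / n * (Q x + Q y + Q (z+1)) + (1 - (x / n + y / n + z / n)) * (Q x + Q y + Q z)"
    unfolding Q'_def by (simp add: algebra_simps add_divide_distrib)
  with one have conv: "Q' x + Q' y + Q' z = x / n * (Q (x+1) + Q y + Q z) + y / n * (Q x + Q (y+1) + Q z)
      + z / n * (Q x + Q y + Q (z+1))"
    by simp
  show ?thesis
  proof (rule ccontr)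
    assume neg: "\<not> ?thesis"
    then have pos: "Q x + Q y + Q z > 0" if "x + y + z = n + 1" "x \<le> M + 1" "y \<le> M + 1" "z \<le> M + 1"
      for x y z using that not_le by blast
    have a: "Q (x+1) + Q y + Q z > 0" "Q x + Q (y+1) + Q z > 0" "Q x + Q y + Q (z+1) > 0"
      by (rule pos; use xyz in simp)+
    define e where "e = min (Q (x+1) + Q y + Q z) (min (Q x + Q (y+1) + Q z) (Q x + Q y + Q (z+1)))"
    have e: "e > 0" using a by (simp add: e_def)
    have "(x / n + y / n + z / n) * e \<le> x / n * (Q (x+1) + Q y + Q z) + y / n * (Q x + Q (y+1) + Q z)
      + z / n * (Q x + Q y + Q (z+1))"
      unfolding distrib_right by (intro add_mono mult_left_mono) (auto simp: e_def)
    with one conv xyz(5) e show False by simp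
  qed
qed

text \<open>
  Sums divisible by three are covered by \<open>equal_thirds_triple\<close>, and the other residues are reached by at
  most two size-biased steps. These steps cannot start from the sum \<open>0\<close> and cannot keep \<open>M + 1 \<le> n\<close> from
  the sum \<open>1\<close>, so for the sums \<open>1\<close> and \<open>2\<close> suitable triples are listed.
\<close>
lemma prefix_nonpos_triple:
  fixes Q :: "nat \<Rightarrow> real"
  assumes "2 * n \<le> 3 * M" and "\<And>k. k \<le> M \<Longrightarrow> (\<Sum>x\<le>k. Q x) \<le> 0"
  shows "\<exists>x y z. x + y + z = n \<and> x \<le> M \<and> y \<le> M \<and> z \<le> M \<and> Q x + Q y + Q z \<le> 0"
proof -
  define j where "j = n div 3"
  have zero: "\<exists>x y z. x + y + z = 3 * j \<and> x \<le> 2*j \<and> y \<le> 2*j \<and> z \<le> 2*j \<and> Q x + Q y + Q z \<le> 0"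
    if "\<And>k. k \<le> 2*j \<Longrightarrow> (\<Sum>x\<le>k. Q x) \<le> 0" for Q :: "nat \<Rightarrow> real"
    using that[of "2*j"] by (intro equal_thirds_triple) auto
  have one: "\<exists>x y z. x + y + z = 3 * j + 1 \<and> x \<le> 2*j+1 \<and> y \<le> 2*j+1 \<and> z \<le> 2*j+1 \<and> Q x + Q y + Q z \<le> 0"
    if Q: "\<And>k. k \<le> 2*j+1 \<Longrightarrow> (\<Sum>x\<le>k. Q x) \<le> 0" for Q :: "nat \<Rightarrow> real"
  proof (cases "j = 0")
    case True
    have "Q 0 + Q 0 + Q 1 \<le> 0" using Q[of 0] Q[of 1] True by simp
    then show ?thesis using True by (intro exI[of _ 0] exI[of _ 1]) auto
  next
    case False
    then show ?thesis using size_biased_step[of "3*j" "2*j" Q, OF _ _ Q zero] by simp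
  qed
  have two: "\<exists>x y z. x + y + z = 3 * j + 2 \<and> x \<le> 2*j+2 \<and> y \<le> 2*j+2 \<and> z \<le> 2*j+2 \<and> Q x + Q y + Q z \<le> 0"
    if Q: "\<And>k. k \<le> 2*j+2 \<Longrightarrow> (\<Sum>x\<le>k. Q x) \<le> 0" for Q :: "nat \<Rightarrow> real"
  proof (cases "j = 0")
    case True
    have "(Q 0 + Q 0 + Q 2) + (Q 0 + Q 1 + Q 1) \<le> 0"
      using Q[of 0] Q[of 1] Q[of 2] True by (simp add: numeral_2_eq_2)
    then have "Q 0 + Q 0 + Q 2 \<le> 0 \<or> Q 0 + Q 1 + Q 1 \<le> 0" by linarith
    then show ?thesis
    proof
      assume "Q 0 + Q 0 + Q 2 \<le> 0"
      then show ?thesis using True by (intro exI[of _ 0] exI[of _ 2]) auto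
    next
      assume "Q 0 + Q 1 + Q 1 \<le> 0"
      then show ?thesis using True by (intro exI[of _ 0] exI[of _ 1]) auto
    qed
  next
    case False
    then show ?thesis using size_biased_step[of "3*j+1" "2*j+1" Q, OF _ _ _ one] Q by simp
  qed
  consider "n = 3*j" | "n = 3*j+1" | "n = 3*j+2"
    unfolding j_def by linarith
  then show ?thesis
  proof cases
    case 1
    then have "2*j \<le> M" using assms(1) by linarith
    with zero[of Q] assms(2) 1 show ?thesis by (meson order_trans)
  next
    case 2
    then have "2*j+1 \<le> M" using assms(1) by linarith
    with one[of Q] assms(2) 2 show ?thesis by (meson order_trans)
  next
    case 3
    then have "2*j+2 \<le> M" using assms(1) by linarith
    with two[of Q] assms(2) 3 show ?thesis by (meson order_trans)
  qed
qed

text \<open>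
  The points \<open>(t div 2, Suc t div 2)\<close> form the staircase from the origin along the diagonal. Its two
  coordinates together take every value four times, apart from the extreme ones.
\<close>
lemma stair_sum_even:
  fixes Q :: "nat \<Rightarrow> real"
  shows "(\<Sum>t\<le>2*g. Q (t div 2) + Q (Suc t div 2)) = 4 * (\<Sum>i\<le>g. Q i) - Q 0 - Q g"
  by (induction g) (simp_all add: algebra_simps)

lemma stair_sum_odd:
  fixes Q :: "nat \<Rightarrow> real"
  shows "(\<Sum>t\<le>2*g+1. Q (t div 2) + Q (Suc t div 2)) = 4 * (\<Sum>i\<le>g. Q i) - Q 0 + Q (g + 1)"
  using stair_sum_even[of Q g] by simp

text \<open>
  Two lattice paths from \<open>(0, 0)\<close> to \<open>(g, h - g)\<close> meet every antidiagonal \<open>y + z = t\<close>, \<open>t \<le> h\<close>, once: the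
  staircase, whose coordinates slightly avoid the end values, and the L-shaped path, whose coordinates
  prefer them. Taking the staircase \<open>g\<close> times and the L-shaped path once balances the coordinates: their
  counts become constant or decreasing on \<open>{..h - g}\<close>, so that sums over prefixes control the result.
\<close>
lemma path_triple:
  fixes Q R :: "nat \<Rightarrow> real"
  assumes R: "(\<Sum>t\<le>h. R t) \<le> 0" and Q: "\<And>k. 2 * k \<le> h + 1 \<Longrightarrow> (\<Sum>i\<le>k. Q i) \<le> 0"
  shows "\<exists>y z. 2 * y \<le> h + 1 \<and> 2 * z \<le> h + 1 \<and> y + z \<le> h \<and> R (y + z) + Q y + Q z \<le> 0"
proof (rule ccontr)
  assume "\<not> ?thesis"
  then have pos: "R t + Q y + Q z > 0" if "2 * y \<le> h + 1" "2 * z \<le> h + 1" "y + z \<le> h" "t = y + z" for y z t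
    using that not_le by blast
  define g where "g = h div 2"
  define g' where "g' = h - g"
  have stair: "0 \<le> (\<Sum>t\<le>h. R t + Q (t div 2) + Q (Suc t div 2))"
    by (intro sum_nonneg less_imp_le[OF pos]) auto
  have "0 < (\<Sum>i\<le>g'. R i + Q 0 + Q i)"
    by (intro sum_pos pos) (auto simp: g_def g'_def)
  moreover have "0 \<le> (\<Sum>i<g. R (g' + 1 + i) + Q g' + Q (i + 1))"
    by (intro sum_nonneg less_imp_le[OF pos]) (auto simp: g_def g'_def)
  moreover have "(\<Sum>t\<le>h. R t) = (\<Sum>i\<le>g'. R i) + (\<Sum>i<g. R (g' + 1 + i))"
  proof -
    have "{..h} = {..<g'+1+g}" by (auto simp: g_def g'_def)
    then have "(\<Sum>t\<le>h. R t) = (\<Sum>t<g'+1+g. R t)" by simp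
    also have "\<dots> = (\<Sum>t<g'+1. R t) + (\<Sum>i<g. R (g' + 1 + i))"
      by (induction g) simp_all
    finally show ?thesis by (simp add: lessThan_Suc_atMost)
  qed
  moreover have "(\<Sum>i<g. Q (i + 1)) = (\<Sum>i\<le>g. Q i) - Q 0"
    by (induction g) simp_all
  ultimately have L: "0 < (\<Sum>t\<le>h. R t) + g' * Q 0 + (\<Sum>i\<le>g'. Q i) + g * Q g' + (\<Sum>i\<le>g. Q i)"
    by (simp add: sum.distrib algebra_simps)
  have "0 \<le> g * ((\<Sum>t\<le>h. R t) + (\<Sum>t\<le>h. Q (t div 2) + Q (Suc t div 2)))"
    using stair by (intro mult_nonneg_nonneg) (simp_all add: sum.distrib algebra_simps)
  with L have comb: "0 < (g + 1) * (\<Sum>t\<le>h. R t) + g * (\<Sum>t\<le>h. Q (t div 2) + Q (Suc t div 2))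
      + g' * Q 0 + (\<Sum>i\<le>g'. Q i) + g * Q g' + (\<Sum>i\<le>g. Q i)"
    by (simp add: algebra_simps)
  have gR: "(g + 1) * (\<Sum>t\<le>h. R t) \<le> 0" using R by (intro mult_nonneg_nonpos) auto
  have Sg: "(\<Sum>i\<le>g. Q i) \<le> 0" "(\<Sum>i\<le>g'. Q i) \<le> 0" "Q 0 \<le> 0"
    using Q[of g] Q[of g'] Q[of 0] by (auto simp: g_def g'_def)
  show False
  proof (cases "even h")
    case True
    then have h: "h = 2 * g" "g' = g" by (auto simp: g_def g'_def)
    have "0 < (g + 1) * (\<Sum>t\<le>h. R t) + (4 * g + 2) * (\<Sum>i\<le>g. Q i)"
      using comb[unfolded h stair_sum_even] unfolding h by (simp add: algebra_simps)
    moreover have "(4 * g + 2) * (\<Sum>i\<le>g. Q i) \<le> 0"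
      using Sg by (intro mult_nonneg_nonpos) auto
    ultimately show False using gR by linarith
  next
    case False
    then have h: "h = 2 * g + 1" "g' = g + 1" by (auto simp: g_def g'_def elim!: oddE)
    have "0 < (g + 1) * (\<Sum>t\<le>h. R t) + (2 * g + 1) * ((\<Sum>i\<le>g. Q i) + (\<Sum>i\<le>g'. Q i)) + Q 0"
      using comb[unfolded h stair_sum_odd] unfolding h by (simp add: algebra_simps)
    moreover have "(2 * g + 1) * ((\<Sum>i\<le>g. Q i) + (\<Sum>i\<le>g'. Q i)) \<le> 0"
      using Sg by (intro mult_nonneg_nonpos) auto
    ultimately show False using gR Sg by linarith
  qed
qed

text \<open>
  Since prefix sums are nonnegative and vanish at \<open>m1\<close> and \<open>m2\<close>, the sums over intervals ending in \<open>m1\<close> or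
  \<open>m2\<close> are nonpositive. In each of three cases a family of triples with sum \<open>N\<close> is spread over such
  intervals. If \<open>m1 + m2 \<le> N\<close>, one entry is \<open>m1\<close> and the other two run through an interval ending in \<open>m2\<close>
  in opposite directions. If \<open>N \<le> 3 * m1\<close>, all three entries lie below \<open>m1\<close>, and counting down from \<open>m1\<close>
  leads to \<open>prefix_nonpos_triple\<close>. Otherwise one entry runs through an interval ending in \<open>m2\<close>, and the
  distances of the other two from \<open>m1\<close> follow the paths of \<open>path_triple\<close>.
\<close>
lemma tight_prefix_triple:
  fixes H :: "nat \<Rightarrow> real"
  assumes m1: "3 * m1 \<le> 2 * N" and m2: "2 * N < 3 * m2" "m2 \<le> N"
    and nonneg: "\<And>k. k \<le> N \<Longrightarrow> 0 \<le> (\<Sum>x\<le>k. H x)"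
    and tight: "(\<Sum>x\<le>m1. H x) = 0" "(\<Sum>x\<le>m2. H x) = 0"
  shows "\<exists>x y z. x + y + z = N \<and> H x + H y + H z \<le> 0"
proof -
  have suffix: "(\<Sum>x\<in>{k..m}. H x) \<le> 0" if "m \<in> {m1, m2}" for k m
  proof (cases "k \<le> m")
    case True
    have mN: "m \<le> N" using that m1 m2 by auto
    have "(\<Sum>x\<le>m. H x) = (\<Sum>x<k. H x) + (\<Sum>x\<in>{k..m}. H x)"
      using True by (subst sum.union_disjoint[symmetric]) (auto intro!: sum.cong)
    moreover have "0 \<le> (\<Sum>x<k. H x)"
      using nonneg[of "k - 1"] True mN by (cases k) (auto simp: lessThan_Suc_atMost)
    moreover have "(\<Sum>x\<le>m. H x) = 0" using that tight by auto
    ultimately show ?thesis by linarith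
  qed simp
  have rev_prefix: "(\<Sum>i\<le>k. H (m1 - i)) \<le> 0" if "k \<le> m1" for k
  proof -
    have "(\<Sum>i\<le>k. H (m1 - i)) = (\<Sum>x\<in>{m1-k..m1}. H x)"
      by (rule sum.reindex_bij_witness[of _ "\<lambda>x. m1 - x" "\<lambda>i. m1 - i"]) (use that in auto)
    then show ?thesis using suffix[of m1] by simp
  qed
  consider "m1 + m2 \<le> N" | "N \<le> 3 * m1" | "3 * m1 < N" "N < m1 + m2" by linarith
  then show ?thesis
  proof cases
    case 1
    define k where "k = N - m1 - m2"
    show ?thesis
    proof (rule ccontr)
      assume "\<not> ?thesis"
      then have pos: "H x + H y + H z > 0" if "x + y + z = N" for x y z
        using that not_le by blast
      have "0 < (\<Sum>y\<in>{k..m2}. H m1 + H y + H (N - m1 - y))"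
        by (rule sum_pos) (use 1 m1 m2 in \<open>auto intro!: pos simp: k_def\<close>)
      moreover have "(\<Sum>y\<in>{k..m2}. H (N - m1 - y)) = (\<Sum>y\<in>{k..m2}. H y)"
        by (rule sum.reindex_bij_witness[of _ "\<lambda>y. N - m1 - y" "\<lambda>y. N - m1 - y"])
           (use 1 in \<open>auto simp: k_def\<close>)
      moreover have "real (card {k..m2}) * H m1 \<le> 0"
        using suffix[of m1 m1] by (intro mult_nonneg_nonpos of_nat_0_le_iff) auto
      moreover have "(\<Sum>y\<in>{k..m2}. H y) \<le> 0" by (rule suffix) simp
      ultimately show False unfolding sum.distrib sum_constant by linarith
    qed
  next
    case 2
    have "\<exists>x y z. x + y + z = 3 * m1 - N \<and> x \<le> m1 \<and> y \<le> m1 \<and> z \<le> m1 \<and>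
        H (m1 - x) + H (m1 - y) + H (m1 - z) \<le> 0"
      by (rule prefix_nonpos_triple[where Q = "\<lambda>i. H (m1 - i)"]) (use m1 rev_prefix in auto)
    then obtain x y z where "x + y + z = 3 * m1 - N" "x \<le> m1" "y \<le> m1" "z \<le> m1"
        "H (m1 - x) + H (m1 - y) + H (m1 - z) \<le> 0" by blast
    then show ?thesis
      using 2 by (intro exI[of _ "m1 - x"] exI[of _ "m1 - y"] exI[of _ "m1 - z"]) auto
  next
    case 3
    define h where "h = m2 + 2 * m1 - N"
    have h: "h \<le> 2 * m1" "h \<le> m2" "N + h = m2 + 2 * m1" using 3 m2 by (auto simp: h_def)
    have "\<exists>y z. 2 * y \<le> h + 1 \<and> 2 * z \<le> h + 1 \<and> y + z \<le> h \<and>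
        H (m2 - h + (y + z)) + H (m1 - y) + H (m1 - z) \<le> 0"
    proof (rule path_triple[where R = "\<lambda>t. H (m2 - h + t)" and Q = "\<lambda>i. H (m1 - i)"])
      have "(\<Sum>t\<le>h. H (m2 - h + t)) = (\<Sum>x\<in>{m2-h..m2}. H x)"
        by (rule sum.reindex_bij_witness[of _ "\<lambda>x. x - (m2 - h)" "\<lambda>t. m2 - h + t"]) (use h in auto)
      then show "(\<Sum>t\<le>h. H (m2 - h + t)) \<le> 0" using suffix[of m2] by simp
      show "(\<Sum>i\<le>k. H (m1 - i)) \<le> 0" if "2 * k \<le> h + 1" for k
        by (rule rev_prefix) (use that h in linarith)
    qed
    then obtain y z where yz: "2 * y \<le> h + 1" "2 * z \<le> h + 1" "y + z \<le> h"
        "H (m2 - h + (y + z)) + H (m1 - y) + H (m1 - z) \<le> 0" by blast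
    have "y \<le> m1" "z \<le> m1" using yz h by linarith+
    then have "m2 - h + (y + z) + (m1 - y) + (m1 - z) = N" using h yz by linarith
    with yz show ?thesis by blast
  qed
qed

lemma continuous_on_Min_family:
  fixes f :: "'i \<Rightarrow> 'a::topological_space \<Rightarrow> real"
  assumes "finite A" "A \<noteq> {}" "\<And>i. i \<in> A \<Longrightarrow> continuous_on S (f i)"
  shows "continuous_on S (\<lambda>x. Min ((\<lambda>i. f i x) ` A))"
  using assms
proof (induction A rule: finite_ne_induct)
  case (insert i A)
  then have "continuous_on S (\<lambda>x. min (f i x) (Min ((\<lambda>i. f i x) ` A)))"
    by (intro continuous_on_min) auto
  then show ?case using insert.hyps by simp
qed simp

text \<open>
  As \<open>l\<close> grows, the averages over prefixes \<open>{..m}\<close> with \<open>3 * m \<le> 2 * N\<close> fall or stay, and the others rise.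
  By continuity there is an \<open>l\<close> at which the least averages of the two groups agree. If this common value
  were negative, subtracting it would give a function to which \<open>tight_prefix_triple\<close> applies.
\<close>
lemma tilt_to_nonneg_prefix_sums:
  fixes F :: "nat \<Rightarrow> real"
  assumes N: "N \<ge> 1" and F: "\<And>x y z. x + y + z = N \<Longrightarrow> 0 \<le> F x + F y + F z"
  shows "\<exists>l. \<forall>k\<le>N. 0 \<le> (\<Sum>x\<le>k. F x + l * (3 * real x - real N))"
proof -
  define avg where "avg m l = (\<Sum>x\<le>m. F x) / (real m + 1) + l * ((3 * real m - 2 * real N) / 2)" for m l
  have lin: "(\<Sum>x\<le>m. 3 * real x - real N) = (real m + 1) * ((3 * real m - 2 * real N) / 2)" for m
    by (induction m) (simp_all add: field_simps)
  have prefix: "(\<Sum>x\<le>m. F x + l * (3 * real x - real N)) = (real m + 1) * avg m l" for m l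
    unfolding sum.distrib sum_distrib_left[symmetric] lin avg_def by (simp add: field_simps)
  define A B where "A = {m. 3 * m \<le> 2 * N}" and "B = {m. 2 * N < 3 * m \<and> m \<le> N}"
  have A: "finite A" "0 \<in> A" by (auto simp: A_def intro: finite_subset[of _ "{..N}"])
  have B: "finite B" "N \<in> B" using N by (auto simp: B_def)
  have AB: "A \<union> B = {..N}" by (auto simp: A_def B_def)
  define C where "C = (\<Sum>m\<le>N. \<bar>(\<Sum>x\<le>m. F x) / (real m + 1)\<bar>)"
  have C: "\<bar>(\<Sum>x\<le>m. F x) / (real m + 1)\<bar> \<le> C" if "m \<le> N" for m
    unfolding C_def by (rule member_le_sum) (use that in auto)
  have C0: "0 \<le> C" by (simp add: C_def sum_nonneg)
  define a b where "a l = Min ((\<lambda>m. avg m l) ` A)" and "b l = Min ((\<lambda>m. avg m l) ` B)" for l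
  have a_le: "a l \<le> avg m l" if "m \<in> A" for m l using A that by (auto simp: a_def)
  have b_le: "b l \<le> avg m l" if "m \<in> B" for m l using B that by (auto simp: b_def)
  have "continuous_on S (\<lambda>l. b l - a l)" for S
    unfolding a_def b_def avg_def using A B
    by (intro continuous_on_diff continuous_on_Min_family continuous_intros) auto
  moreover have "b (- 4 * C) - a (- 4 * C) \<le> 0"
  proof -
    have "b (- 4 * C) \<le> avg N (- 4 * C)" using B by (intro b_le)
    also have "\<dots> = (\<Sum>x\<le>N. F x) / (real N + 1) - 2 * C * real N"
      by (simp add: avg_def)
    also have "\<dots> \<le> C - 2 * C * 1"
      using abs_le_D1[OF C[OF order_refl]] mult_left_mono[of 1 "real N" "2 * C"] N C0
      by (intro diff_mono) auto
    finally have "b (- 4 * C) \<le> - C" by simp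
    moreover have "- C \<le> a (- 4 * C)"
      unfolding a_def
    proof (subst Min_ge_iff)
      show "\<forall>y\<in>(\<lambda>m. avg m (- 4 * C)) ` A. - C \<le> y"
      proof safe
        fix m assume m: "m \<in> A"
        have "0 \<le> - 4 * C * ((3 * real m - 2 * real N) / 2)"
          using m C0 by (intro mult_nonpos_nonpos) (auto simp: A_def)
        moreover have "m \<le> N" using m AB by auto
        ultimately show "- C \<le> avg m (- 4 * C)"
          using abs_le_D2[OF C[of m]] unfolding avg_def by linarith
      qed
    qed (use A in auto)
    ultimately show ?thesis by simp
  qed
  moreover have "0 \<le> b (4 * C) - a (4 * C)"
  proof -
    have "a (4 * C) \<le> avg 0 (4 * C)" using A by (intro a_le)
    also have "\<dots> \<le> C"
      using abs_le_D1[OF C[of 0]] mult_nonneg_nonneg[OF C0, of "real N"] by (simp add: avg_def)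
    finally have "a (4 * C) \<le> C" .
    moreover have "C \<le> b (4 * C)"
      unfolding b_def
    proof (subst Min_ge_iff)
      show "\<forall>y\<in>(\<lambda>m. avg m (4 * C)) ` B. C \<le> y"
      proof safe
        fix m assume m: "m \<in> B"
        have "4 * C * (1 / 2) \<le> 4 * C * ((3 * real m - 2 * real N) / 2)"
          using m C0 by (intro mult_left_mono) (auto simp: B_def)
        moreover have "m \<le> N" using m AB by auto
        ultimately show "C \<le> avg m (4 * C)"
          using abs_le_D2[OF C[of m]] unfolding avg_def by linarith
      qed
    qed (use B in auto)
    ultimately show ?thesis by simp
  qed
  ultimately obtain l where l: "b l - a l = 0"
    using IVT'[of "\<lambda>l. b l - a l" "- 4 * C" 0 "4 * C"] C0 by auto
  have "a l \<in> (\<lambda>m. avg m l) ` A"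
    unfolding a_def using A by (intro Min_in) auto
  then obtain m1 where m1: "m1 \<in> A" "a l = avg m1 l" by blast
  have "b l \<in> (\<lambda>m. avg m l) ` B"
    unfolding b_def using B by (intro Min_in) auto
  then obtain m2 where m2: "m2 \<in> B" "b l = avg m2 l" by blast
  have least: "a l \<le> avg k l" if "k \<le> N" for k
    using a_le[of k l] b_le[of k l] that AB l by auto
  have "a l \<ge> 0"
  proof (rule ccontr)
    assume neg: "\<not> a l \<ge> 0"
    define H where "H x = F x + l * (3 * real x - real N) - a l" for x
    have preH: "(\<Sum>x\<le>k. H x) = (real k + 1) * (avg k l - a l)" for k
      unfolding H_def sum_subtractf prefix by (simp add: algebra_simps)
    have "\<exists>x y z. x + y + z = N \<and> H x + H y + H z \<le> 0"
    proof (rule tight_prefix_triple)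
      show "3 * m1 \<le> 2 * N" "2 * N < 3 * m2" "m2 \<le> N"
        using m1 m2 by (auto simp: A_def B_def)
    qed (use least m1 m2 l in \<open>auto simp: preH\<close>)
    then obtain x y z where xyz: "x + y + z = N" "H x + H y + H z \<le> 0" by blast
    have "H x + H y + H z = F x + F y + F z - 3 * a l"
      unfolding H_def xyz(1)[symmetric] by (simp add: algebra_simps)
    with F[OF xyz(1)] xyz(2) neg show False by linarith
  qed
  then have "\<forall>k\<le>N. 0 \<le> (\<Sum>x\<le>k. F x + l * (3 * real x - real N))"
    unfolding prefix using least by (force intro!: mult_nonneg_nonneg)
  then show ?thesis ..
qed

lemma sum_by_parts_nonneg:
  fixes p G :: "nat \<Rightarrow> real"
  assumes "\<And>k. k < N \<Longrightarrow> p (Suc k) \<le> p k" "0 \<le> p N" "\<And>k. k \<le> N \<Longrightarrow> 0 \<le> (\<Sum>x\<le>k. G x)"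
  shows "0 \<le> (\<Sum>x\<le>N. p x * G x)"
proof -
  have eq: "(\<Sum>x\<le>N. p x * G x) = (\<Sum>k<N. (p k - p (Suc k)) * (\<Sum>x\<le>k. G x)) + p N * (\<Sum>x\<le>N. G x)"
    by (induction N) (simp_all add: algebra_simps)
  show ?thesis
    unfolding eq using assms(1,2)
    by (intro add_nonneg_nonneg sum_nonneg[of "{..<N}"] mult_nonneg_nonneg assms(3)) auto
qed

text \<open>
  The tilt by \<open>l * (3 * x - N)\<close> is invisible: it adds nothing to a triple with sum \<open>N\<close>, and nothing to the
  integral against a law with mean \<open>N / 3\<close>.
\<close>
lemma decreasing_dual_inequality:
  fixes p F :: "nat \<Rightarrow> real"
  assumes N: "N \<ge> 1" and F: "\<And>x y z. x + y + z = N \<Longrightarrow> 0 \<le> F x + F y + F z"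
    and p: "\<And>k. k < N \<Longrightarrow> p (Suc k) \<le> p k" "0 \<le> p N"
    and mean: "(\<Sum>x\<le>N. p x * (3 * real x - real N)) = 0"
  shows "0 \<le> (\<Sum>x\<le>N. p x * F x)"
proof -
  obtain l where l: "\<forall>k\<le>N. 0 \<le> (\<Sum>x\<le>k. F x + l * (3 * real x - real N))"
    using tilt_to_nonneg_prefix_sums[of N F] N F by blast
  have "0 \<le> (\<Sum>x\<le>N. p x * (F x + l * (3 * real x - real N)))"
    by (rule sum_by_parts_nonneg) (use p l in auto)
  also have "\<dots> = (\<Sum>x\<le>N. p x * F x) + l * (\<Sum>x\<le>N. p x * (3 * real x - real N))"
    unfolding sum_distrib_left sum.distrib[symmetric]
    by (intro sum.cong refl) (simp add: algebra_simps)
  finally show ?thesis using mean by simp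
qed

section \<open>Three variables with constant sum and a prescribed decreasing law\<close>

definition triples :: "nat \<Rightarrow> (nat \<times> nat \<times> nat) set" where
  "triples N = {(x, y, z). x + y + z = N}"

definition coord :: "nat \<Rightarrow> nat \<times> nat \<times> nat \<Rightarrow> nat" where
  "coord i t = (if i = 0 then fst t else if i = 1 then fst (snd t) else snd (snd t))"

text \<open>
  Rotations act on the coordinates of a triple and are used to make the three marginals of a weighting
  of triples, or the three types of a word of triples, equal.
\<close>
definition rot :: "nat \<times> nat \<times> nat \<Rightarrow> nat \<times> nat \<times> nat" where
  "rot t = (fst (snd t), snd (snd t), fst t)"

lemma finite_triples: "finite (triples N)"
  by (rule finite_subset[of _ "{..N} \<times> {..N} \<times> {..N}"]) (auto simp: triples_def)

lemma coord_le: "t \<in> triples N \<Longrightarrow> coord i t \<le> N"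
  by (auto simp: triples_def coord_def)

lemma coord_sum: "t \<in> triples N \<Longrightarrow> coord 0 t + coord 1 t + coord 2 t = N"
  by (auto simp: triples_def coord_def)

lemma rot_in_triples: "rot t \<in> triples N \<longleftrightarrow> t \<in> triples N"
  by (auto simp: triples_def rot_def)

lemma rot3: "rot (rot (rot t)) = t"
  by (simp add: rot_def)

lemma sum_rot: "(\<Sum>t\<in>triples N. f (rot t)) = (\<Sum>t\<in>triples N. f t)"
  by (rule sum.reindex_bij_witness[of _ "\<lambda>t. rot (rot t)" rot]) (auto simp: rot_in_triples rot3)

text \<open>
  Farkas' lemma only provides a weighting for which the sum of the three marginals is \<open>p\<close>; adding up its
  three rotations turns this into three marginals equal to \<open>p\<close>. The marginals are stated as integrals of
  test functions \<open>h\<close>, the form that is used for words later.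
\<close>
lemma decreasing_coupling:
  fixes p :: "nat \<Rightarrow> real"
  assumes N: "N \<ge> 1" and p: "\<And>k. k < N \<Longrightarrow> p (Suc k) \<le> p k" "0 \<le> p N"
    and mean: "(\<Sum>x\<le>N. p x * (3 * real x - real N)) = 0"
  shows "\<exists>w. (\<forall>t\<in>triples N. 0 \<le> w t) \<and>
    (\<forall>i<3. \<forall>h. (\<Sum>t\<in>triples N. w t * h (coord i t)) = (\<Sum>x\<le>N. p x * h x))"
proof -
  define v where "v t j = (\<Sum>i<3. if coord i t = j then 1 else 0 :: real)" for t j
  have v: "(\<Sum>j\<le>N. F j * v t j) = F (coord 0 t) + F (coord 1 t) + F (coord 2 t)"
    if "t \<in> triples N" for t and F :: "nat \<Rightarrow> real"
  proof -
    have "(\<Sum>j\<le>N. F j * v t j) = (\<Sum>i<3. \<Sum>j\<le>N. if coord i t = j then F j else 0)"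
      unfolding v_def sum_distrib_left by (subst sum.swap) (intro sum.cong refl, auto)
    also have "\<dots> = (\<Sum>i<3. F (coord i t))"
      using coord_le[OF that] by (intro sum.cong refl) auto
    finally show ?thesis by (simp add: eval_nat_numeral)
  qed
  have "\<exists>w. (\<forall>t\<in>triples N. 0 \<le> w t) \<and> (\<forall>j\<in>{..N}. p j = (\<Sum>t\<in>triples N. w t * v t j))"
  proof (rule farkas[OF finite_triples finite_atMost])
    fix F assume F: "\<And>t. t \<in> triples N \<Longrightarrow> 0 \<le> (\<Sum>j\<le>N. F j * v t j)"
    have "0 \<le> (\<Sum>j\<le>N. p j * F j)"
    proof (rule decreasing_dual_inequality[OF N _ p mean])
      fix x y z assume "x + y + z = N"
      then have "(x, y, z) \<in> triples N" by (simp add: triples_def)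
      from F[OF this] v[OF this, of F] show "0 \<le> F x + F y + F z" by (simp add: coord_def)
    qed
    then show "0 \<le> (\<Sum>j\<le>N. F j * p j)" by (simp add: mult.commute)
  qed
  then obtain w where w: "\<forall>t\<in>triples N. 0 \<le> w t" "\<And>j. j \<le> N \<Longrightarrow> p j = (\<Sum>t\<in>triples N. w t * v t j)"
    by auto
  define w' where "w' t = w t + w (rot t) + w (rot (rot t))" for t
  have sym: "(\<Sum>t\<in>triples N. w t * (h (coord 0 t) + h (coord 1 t) + h (coord 2 t))) = (\<Sum>x\<le>N. p x * h x)" for h
  proof -
    have "(\<Sum>x\<le>N. p x * h x) = (\<Sum>x\<le>N. \<Sum>t\<in>triples N. w t * (h x * v t x))"
      using w(2) by (intro sum.cong refl) (simp add: sum_distrib_left mult.commute mult.left_commute)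
    also have "\<dots> = (\<Sum>t\<in>triples N. w t * (\<Sum>x\<le>N. h x * v t x))"
      by (subst sum.swap) (simp add: sum_distrib_left)
    finally show ?thesis using v by simp
  qed
  have "(\<Sum>t\<in>triples N. w' t * h (coord i t)) = (\<Sum>x\<le>N. p x * h x)" if i: "i < 3" for i h
  proof -
    have "(\<Sum>t\<in>triples N. w' t * h (coord i t)) =
        (\<Sum>t\<in>triples N. w t * h (coord i t)) + (\<Sum>t\<in>triples N. w (rot t) * h (coord i (rot (rot (rot t))))) +
        (\<Sum>t\<in>triples N. w (rot (rot t)) * h (coord i (rot (rot (rot t)))))"
      by (simp add: w'_def algebra_simps sum.distrib rot3)
    also have "(\<Sum>t\<in>triples N. w (rot t) * h (coord i (rot (rot (rot t))))) =
        (\<Sum>t\<in>triples N. w t * h (coord i (rot (rot t))))"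
      by (rule sum_rot)
    also have "(\<Sum>t\<in>triples N. w (rot (rot t)) * h (coord i (rot (rot (rot t))))) =
        (\<Sum>t\<in>triples N. w (rot t) * h (coord i (rot (rot t))))"
      by (rule sum_rot)
    also have "\<dots> = (\<Sum>t\<in>triples N. w t * h (coord i (rot t)))"
      by (rule sum_rot)
    also have "(\<Sum>t\<in>triples N. w t * h (coord i t)) + (\<Sum>t\<in>triples N. w t * h (coord i (rot (rot t)))) +
        (\<Sum>t\<in>triples N. w t * h (coord i (rot t))) =
        (\<Sum>t\<in>triples N. w t * (h (coord 0 t) + h (coord 1 t) + h (coord 2 t)))"
    proof -
      have "i = 0 \<or> i = 1 \<or> i = 2" using i by auto
      then show ?thesis
        unfolding sum.distrib[symmetric]
        by (intro sum.cong refl) (auto simp: coord_def rot_def algebra_simps)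
    qed
    finally show ?thesis using sym by simp
  qed
  moreover have "\<forall>t\<in>triples N. 0 \<le> w' t"
    using w(1) by (auto simp: w'_def rot_in_triples)
  ultimately show ?thesis by blast
qed


section \<open>The minimiser in the definition of theta\<close>

text \<open>
  Stationarity of \<open>theta_fun q\<close> at its minimiser says that the law proportional to \<open>\<beta> ^ j\<close> has mean
  \<open>(q - 1) / 3\<close>. A minimiser above \<open>1\<close> is impossible because \<open>1 / \<beta>\<close> would then give a smaller value:
  reversing the polynomial shows \<open>theta_fun q (1 / \<beta>) = (\<Sum>j<q. \<beta> ^ j) * \<beta> powr (- 2 * (q - 1) / 3)\<close>.
\<close>
lemma theta_minimiser:
  assumes q: "q \<ge> 2"
  obtains \<beta> where "0 < \<beta>" "\<beta> \<le> 1" "theta q = theta_fun q \<beta>"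
    "(\<Sum>j<q. \<beta> ^ j * (3 * real j - real (q - 1))) = 0"
proof -
  obtain \<beta> where b: "\<beta> > 0" "theta q = theta_fun q \<beta>" "\<And>\<gamma>. \<gamma> > 0 \<Longrightarrow> theta_fun q \<beta> \<le> theta_fun q \<gamma>"
    using theta_attained[OF q] by blast
  define s where "s = (real q - 1) / 3"
  define D where "D = (\<Sum>j<q. real j * \<beta> ^ (j - 1)) * \<beta> powr (- s) + (\<Sum>j<q. \<beta> ^ j) * (- s * \<beta> powr (- s - 1))"
  have "(theta_fun q has_real_derivative D) (at \<beta>)"
    unfolding theta_fun_def s_def[symmetric] D_def
    by (rule derivative_eq_intros refl | use b in simp)+
  then have "D = 0"
  proof (rule DERIV_local_min)
    show "0 < \<beta>" by fact
    show "\<forall>y. \<bar>\<beta> - y\<bar> < \<beta> \<longrightarrow> theta_fun q \<beta> \<le> theta_fun q y"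
      using b(3) by (auto simp: abs_less_iff)
  qed
  moreover have "D * \<beta> powr (s + 1) = (\<Sum>j<q. \<beta> ^ j * (real j - s))"
  proof -
    have "\<beta> powr (- s) * \<beta> powr (s + 1) = \<beta>" "\<beta> powr (- s - 1) * \<beta> powr (s + 1) = 1"
      using b(1) by (simp_all flip: powr_add)
    then have "D * \<beta> powr (s + 1) = (\<Sum>j<q. real j * \<beta> ^ (j - 1)) * \<beta> - s * (\<Sum>j<q. \<beta> ^ j)"
      unfolding D_def distrib_right mult.assoc by simp
    also have "(\<Sum>j<q. real j * \<beta> ^ (j - 1)) * \<beta> = (\<Sum>j<q. real j * \<beta> ^ j)"
      unfolding sum_distrib_right
    proof (intro sum.cong refl)
      show "real j * \<beta> ^ (j - 1) * \<beta> = real j * \<beta> ^ j" for j by (cases j) simp_all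
    qed
    finally show ?thesis by (simp add: algebra_simps sum_subtractf sum_distrib_left)
  qed
  ultimately have "(\<Sum>j<q. \<beta> ^ j * (real j - s)) = 0" by simp
  then have "3 * (\<Sum>j<q. \<beta> ^ j * (real j - s)) = 0" by simp
  moreover have "3 * (\<Sum>j<q. \<beta> ^ j * (real j - s)) = (\<Sum>j<q. \<beta> ^ j * (3 * real j - real (q - 1)))"
  proof -
    have "3 * s = real q - 1" "real (q - 1) = real q - 1"
      using q by (simp_all add: s_def of_nat_diff)
    then have "3 * (real j - s) = 3 * real j - real (q - 1)" for j by (simp only: right_diff_distrib)
    then show ?thesis
      unfolding sum_distrib_left by (intro sum.cong refl) (metis mult.left_commute)
  qed
  ultimately have mean: "(\<Sum>j<q. \<beta> ^ j * (3 * real j - real (q - 1))) = 0" by simp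
  have "\<beta> \<le> 1"
  proof (rule ccontr)
    assume "\<not> \<beta> \<le> 1"
    then have b1: "\<beta> > 1" by simp
    have "(\<Sum>j<q. (1 / \<beta>) ^ j) = (\<Sum>j<q. (1 / \<beta>) ^ (q - 1 - j))"
      by (rule sum.reindex_bij_witness[of _ "\<lambda>j. q - 1 - j" "\<lambda>j. q - 1 - j"]) auto
    also have "\<dots> = (\<Sum>j<q. \<beta> ^ j * \<beta> powr (- (3 * s)))"
    proof (intro sum.cong refl)
      fix j assume j: "j \<in> {..<q}"
      have "(1 / \<beta>) ^ (q - 1 - j) = \<beta> powr (- real (q - 1 - j))"
        using b(1) by (simp add: powr_minus powr_realpow power_inverse divide_inverse)
      also have "- real (q - 1 - j) = real j + (- (3 * s))"
        using j by (auto simp: s_def of_nat_diff field_simps)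
      also have "\<beta> powr \<dots> = \<beta> ^ j * \<beta> powr (- (3 * s))"
        using b(1) by (simp only: powr_add powr_realpow)
      finally show "(1 / \<beta>) ^ (q - 1 - j) = \<beta> ^ j * \<beta> powr (- (3 * s))" .
    qed
    finally have "theta_fun q (1 / \<beta>) = (\<Sum>j<q. \<beta> ^ j) * (\<beta> powr (- (3 * s)) * (1 / \<beta>) powr (- s))"
      unfolding theta_fun_def s_def[symmetric] by (simp add: sum_distrib_right mult.assoc)
    also have "(1 / \<beta>) powr (- s) = \<beta> powr s"
      using b(1) by (simp add: powr_divide powr_minus field_simps)
    also have "\<beta> powr (- (3 * s)) * \<beta> powr s = \<beta> powr (- (2 * s))"
      by (simp flip: powr_add)
    also have "(\<Sum>j<q. \<beta> ^ j) * \<beta> powr (- (2 * s)) < (\<Sum>j<q. \<beta> ^ j) * \<beta> powr (- s)"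
    proof (intro mult_strict_left_mono powr_less_mono)
      show "- (2 * s) < - s" using q by (simp add: s_def)
      show "0 < (\<Sum>j<q. \<beta> ^ j)" using b(1) q by (intro sum_pos) (auto simp: lessThan_empty_iff)
    qed (use b1 in auto)
    finally have "theta_fun q (1 / \<beta>) < theta_fun q \<beta>"
      by (simp add: theta_fun_def s_def)
    with b(3)[of "1 / \<beta>"] b(1) show False by simp
  qed
  with that b mean show ?thesis by blast
qed

lemma theta_ge_1:
  assumes "q \<ge> 2" shows "theta q \<ge> 1"
proof -
  obtain \<beta> where b: "0 < \<beta>" "\<beta> \<le> 1" "theta q = theta_fun q \<beta>"
    using theta_minimiser[OF assms] by metis
  have "\<beta> ^ 0 \<le> (\<Sum>j<q. \<beta> ^ j)"
    using assms b by (intro member_le_sum) auto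
  moreover have "1 \<le> \<beta> powr (- ((real q - 1) / 3))"
    using b assms powr_mono2'[of "- ((real q - 1) / 3)" \<beta> 1] by simp
  ultimately have "1 * 1 \<le> theta_fun q \<beta>"
    unfolding theta_fun_def by (intro mult_mono) auto
  with b show ?thesis by simp
qed

section \<open>Words and their types\<close>

definition words :: "nat \<Rightarrow> 'a set \<Rightarrow> 'a list set" where
  "words n A = {xs. set xs \<subseteq> A \<and> length xs = n}"

lemma words_0 [simp]: "words 0 A = {[]}"
  by (auto simp: words_def)

lemma words_Suc: "words (Suc n) A = (\<lambda>(x, xs). x # xs) ` (A \<times> words n A)"
  by (auto simp: words_def length_Suc_conv)

lemma finite_words: "finite A \<Longrightarrow> finite (words n A)"
  by (induction n) (auto simp: words_Suc)

lemma card_words: "finite A \<Longrightarrow> card (words n A) = card A ^ n"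
  unfolding words_def by (rule card_lists_length_eq)

lemma sum_words_Suc: "(\<Sum>xs\<in>words (Suc n) A. f xs) = (\<Sum>xs\<in>words n A. \<Sum>x\<in>A. f (x # xs))"
proof -
  have "(\<Sum>xs\<in>words (Suc n) A. f xs) = (\<Sum>(x, xs)\<in>A \<times> words n A. f (x # xs))"
    unfolding words_Suc by (subst sum.reindex) (auto simp: inj_on_def case_prod_unfold)
  also have "\<dots> = (\<Sum>x\<in>A. \<Sum>xs\<in>words n A. f (x # xs))"
    by (rule sum.cartesian_product[symmetric])
  also have "\<dots> = (\<Sum>xs\<in>words n A. \<Sum>x\<in>A. f (x # xs))" by (rule sum.swap)
  finally show ?thesis .
qed

text \<open>
  If \<open>p\<close> is the image of the weighting \<open>w\<close> under \<open>c\<close>, then the product weighting of words over \<open>T\<close> is mapped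
  to the product weighting of words over \<open>A\<close>.
\<close>
lemma sum_words_marginal:
  fixes w :: "'t \<Rightarrow> real" and p :: "'a \<Rightarrow> real"
  assumes "\<And>h. (\<Sum>t\<in>T. w t * h (c t)) = (\<Sum>x\<in>A. p x * h x)"
  shows "(\<Sum>\<tau>\<in>words n T. prod_list (map w \<tau>) * g (map c \<tau>)) = (\<Sum>xs\<in>words n A. prod_list (map p xs) * g xs)"
proof (induction n arbitrary: g)
  case (Suc n)
  have "(\<Sum>\<tau>\<in>words (Suc n) T. prod_list (map w \<tau>) * g (map c \<tau>))
      = (\<Sum>\<tau>\<in>words n T. prod_list (map w \<tau>) * (\<Sum>t\<in>T. w t * g (c t # map c \<tau>)))"
    unfolding sum_words_Suc sum_distrib_left by (intro sum.cong refl) simp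
  also have "\<dots> = (\<Sum>\<tau>\<in>words n T. prod_list (map w \<tau>) * (\<Sum>x\<in>A. p x * g (x # map c \<tau>)))"
    using assms[of "\<lambda>x. g (x # map c \<tau>)" for \<tau>] by simp
  also have "\<dots> = (\<Sum>xs\<in>words n A. prod_list (map p xs) * (\<Sum>x\<in>A. p x * g (x # xs)))"
    by (rule Suc)
  also have "\<dots> = (\<Sum>xs\<in>words (Suc n) A. prod_list (map p xs) * g xs)"
    unfolding sum_words_Suc sum_distrib_left by (intro sum.cong refl) simp
  finally show ?case .
qed simp

lemma sum_words_prod: "(\<Sum>xs\<in>words n A. prod_list (map p xs)) = (\<Sum>x\<in>A. p x :: real) ^ n"
  by (induction n) (simp_all add: sum_words_Suc flip: sum_distrib_right sum_distrib_left)

text \<open>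
  The type of a word is its multiset of letters. This is the total weight, under the product of \<open>p\<close>, of
  all words of type \<open>M\<close>.
\<close>
definition class_weight :: "('a \<Rightarrow> real) \<Rightarrow> 'a multiset \<Rightarrow> real" where
  "class_weight p M = real (card (permutations_of_multiset M)) * prod_mset (image_mset p M)"

lemma prod_list_class: "mset xs = M \<Longrightarrow> prod_list (map p xs) = prod_mset (image_mset p M)"
  by (metis mset_map prod_mset_prod_list)

lemma class_weight_eq_sum: "class_weight p M = (\<Sum>xs\<in>permutations_of_multiset M. prod_list (map p xs))"
  unfolding class_weight_def
  by (simp add: prod_list_class[OF permutations_of_multisetD] cong: sum.cong)

lemma class_subset_words:
  "set_mset M \<subseteq> A \<Longrightarrow> permutations_of_multiset M \<subseteq> words (size M) A"
  by (auto simp: permutations_of_multiset_def words_def)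

lemma class_weight_le_1:
  assumes "finite A" "\<And>x. x \<in> A \<Longrightarrow> 0 \<le> p x" "(\<Sum>x\<in>A. p x) = 1" "set_mset M \<subseteq> A"
  shows "class_weight p M \<le> 1"
proof -
  have "class_weight p M \<le> (\<Sum>xs\<in>words (size M) A. prod_list (map p xs))"
    unfolding class_weight_eq_sum
  proof (rule sum_mono2)
    show "finite (words (size M) A)" by (rule finite_words) fact
    show "permutations_of_multiset M \<subseteq> words (size M) A" by (rule class_subset_words) fact
    show "0 \<le> prod_list (map p xs)" if "xs \<in> words (size M) A - permutations_of_multiset M" for xs
      using that assms(2) by (intro prod_list_nonneg) (auto simp: words_def)
  qed
  then show ?thesis using assms by (simp add: sum_words_prod)
qed

lemma prod_mset_nonneg:
  fixes p :: "'a \<Rightarrow> real"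
  shows "(\<And>x. x \<in># M \<Longrightarrow> 0 \<le> p x) \<Longrightarrow> 0 \<le> prod_mset (image_mset p M)"
  by (induction M) auto

text \<open>
  Concatenating a word of type \<open>A\<close> with one of type \<open>B\<close> is injective.
\<close>
lemma class_weight_mult:
  assumes "\<And>x. x \<in># A + B \<Longrightarrow> 0 \<le> p x"
  shows "class_weight p A * class_weight p B \<le> class_weight p (A + B)"
proof -
  have inj: "inj_on (\<lambda>(x, y). x @ y) (permutations_of_multiset A \<times> permutations_of_multiset B)"
  proof (rule inj_onI, clarify)
    fix x y x' y' assume *: "x \<in> permutations_of_multiset A" "x' \<in> permutations_of_multiset A" "x @ y = x' @ y'"
    then have "length x = length x'" by (metis permutations_of_multisetD size_mset)
    with * show "x = x' \<and> y = y'" by simp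
  qed
  have "card (permutations_of_multiset A \<times> permutations_of_multiset B) \<le> card (permutations_of_multiset (A + B))"
    by (rule card_inj_on_le[OF inj _ finite_permutations_of_multiset]) (auto simp: permutations_of_multiset_def)
  then have "real (card (permutations_of_multiset A)) * real (card (permutations_of_multiset B))
      \<le> real (card (permutations_of_multiset (A + B)))"
    by (simp add: card_cartesian_product flip: of_nat_mult)
  then have "real (card (permutations_of_multiset A)) * real (card (permutations_of_multiset B))
      * (prod_mset (image_mset p A) * prod_mset (image_mset p B))
      \<le> real (card (permutations_of_multiset (A + B))) * (prod_mset (image_mset p A) * prod_mset (image_mset p B))"
    using assms by (intro mult_right_mono mult_nonneg_nonneg prod_mset_nonneg) auto
  then show ?thesis by (simp add: class_weight_def mult_ac)
qed

lemma card_types_le: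
  assumes "finite A"
  shows "finite {M. set_mset M \<subseteq> A \<and> size M = n}" "card {M. set_mset M \<subseteq> A \<and> size M = n} \<le> (n + 1) ^ card A"
proof -
  define S where "S = {M. set_mset M \<subseteq> A \<and> size M = n}"
  have inj: "inj_on (\<lambda>M. restrict (count M) A) S"
  proof (rule inj_onI)
    fix M M' assume M: "M \<in> S" "M' \<in> S" and eq: "restrict (count M) A = restrict (count M') A"
    show "M = M'"
    proof (rule multiset_eqI)
      fix x
      show "count M x = count M' x"
      proof (cases "x \<in> A")
        case True
        then show ?thesis using eq by (metis restrict_apply')
      next
        case False
        then have "x \<notin># M" "x \<notin># M'" using M by (auto simp: S_def)
        then show ?thesis by (metis not_in_iff)
      qed
    qed
  qed
  have im: "(\<lambda>M. restrict (count M) A) ` S \<subseteq> A \<rightarrow>\<^sub>E {..n}"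
    by (auto simp: S_def intro: count_le_size)
  have fin: "finite (A \<rightarrow>\<^sub>E {..n})" using assms by (simp add: finite_PiE)
  show "finite {M. set_mset M \<subseteq> A \<and> size M = n}"
    using inj_on_finite[OF inj im fin] by (simp add: S_def)
  have "card S \<le> card (A \<rightarrow>\<^sub>E {..n})" by (rule card_inj_on_le[OF inj im fin])
  then show "card {M. set_mset M \<subseteq> A \<and> size M = n} \<le> (n + 1) ^ card A"
    using assms by (simp add: S_def card_PiE)
qed

text \<open>
  There are only polynomially many types, so the words whose type has weight less than \<open>e\<close> contribute
  little altogether.
\<close>
lemma light_words_weight:
  assumes A: "finite A" and p: "\<And>x. x \<in> A \<Longrightarrow> 0 \<le> p x" and e: "e \<ge> 0"
  shows "(\<Sum>xs\<in>words n A. prod_list (map p xs) * (if class_weight p (mset xs) < e then 1 else 0))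
    \<le> (n + 1) ^ card A * e"
proof -
  define S where "S = {M. set_mset M \<subseteq> A \<and> size M = n}"
  have S: "finite S" "card S \<le> (n + 1) ^ card A" using card_types_le[OF A] by (auto simp: S_def)
  have "(\<Sum>xs\<in>words n A. prod_list (map p xs) * (if class_weight p (mset xs) < e then 1 else 0))
      = (\<Sum>M\<in>S. \<Sum>xs\<in>{xs\<in>words n A. mset xs = M}. prod_list (map p xs) * (if class_weight p (mset xs) < e then 1 else 0))"
    by (rule sum.group[symmetric]) (auto simp: S finite_words A, auto simp: S_def words_def)
  also have "\<dots> \<le> (\<Sum>M\<in>S. e)"
  proof (rule sum_mono)
    fix M assume M: "M \<in> S"
    have eq: "{xs\<in>words n A. mset xs = M} = permutations_of_multiset M"
      using M by (auto simp: S_def words_def permutations_of_multiset_def)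
    have "(\<Sum>xs\<in>{xs\<in>words n A. mset xs = M}. prod_list (map p xs) * (if class_weight p (mset xs) < e then 1 else 0))
        = class_weight p M * (if class_weight p M < e then 1 else 0)"
      unfolding eq class_weight_eq_sum[of p M] sum_distrib_right
      by (intro sum.cong refl) (auto simp: permutations_of_multiset_def class_weight_eq_sum)
    also have "\<dots> \<le> e" using e by simp
    finally show "(\<Sum>xs\<in>{xs\<in>words n A. mset xs = M}. prod_list (map p xs) * (if class_weight p (mset xs) < e then 1 else 0)) \<le> e" .
  qed
  also have "\<dots> = card S * e" by simp
  also have "\<dots> \<le> (n + 1) ^ card A * e"
  proof (rule mult_right_mono)
    show "real (card S) \<le> real ((n + 1) ^ card A)" using S(2) by (simp only: of_nat_le_iff)
  qed fact
  finally show ?thesis .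
qed

text \<open>
  Union bound: under the product weighting each of the three coordinate words is light with probability
  at most \<open>1 / 4\<close>.
\<close>
lemma exists_heavy_triple_word:
  fixes w :: "nat \<times> nat \<times> nat \<Rightarrow> real" and p :: "nat \<Rightarrow> real"
  assumes w: "\<And>t. t \<in> triples N \<Longrightarrow> 0 \<le> w t"
    and marg: "\<And>i h. i < 3 \<Longrightarrow> (\<Sum>t\<in>triples N. w t * h (coord i t)) = (\<Sum>x\<le>N. p x * h x)"
    and p: "\<And>x. x \<le> N \<Longrightarrow> 0 \<le> p x" "(\<Sum>x\<le>N. p x) = 1"
    and e: "0 \<le> e" "4 * (real m + 1) ^ (N + 1) * e \<le> 1"
  shows "\<exists>\<tau>\<in>words m (triples N). \<forall>i<3. e \<le> class_weight p (mset (map (coord i) \<tau>))"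
proof (rule ccontr)
  assume "\<not> ?thesis"
  then have neg: "\<And>\<tau>. \<tau> \<in> words m (triples N) \<Longrightarrow> \<exists>i<3. class_weight p (mset (map (coord i) \<tau>)) < e"
    by force
  define light where "light xs = (if class_weight p (mset xs) < e then 1 else 0 :: real)" for xs
  have light0: "0 \<le> light xs" for xs by (simp add: light_def)
  have "(\<Sum>t\<in>triples N. w t) = 1"
    using marg[of 0 "\<lambda>_. 1"] p by simp
  then have "1 = (\<Sum>\<tau>\<in>words m (triples N). prod_list (map w \<tau>))"
    by (simp add: sum_words_prod)
  also have "\<dots> \<le> (\<Sum>\<tau>\<in>words m (triples N). \<Sum>i<3. prod_list (map w \<tau>) * light (map (coord i) \<tau>))"
  proof (rule sum_mono)
    fix \<tau> assume t: "\<tau> \<in> words m (triples N)"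
    then have pos: "0 \<le> prod_list (map w \<tau>)"
      by (intro prod_list_nonneg) (auto simp: words_def subset_iff intro!: w)
    obtain i where i: "i < 3" "light (map (coord i) \<tau>) = 1"
      using neg[OF t] by (auto simp: light_def)
    have "prod_list (map w \<tau>) = prod_list (map w \<tau>) * light (map (coord i) \<tau>)" using i by simp
    also have "\<dots> \<le> (\<Sum>i<3. prod_list (map w \<tau>) * light (map (coord i) \<tau>))"
      by (rule member_le_sum) (use i pos light0 in auto)
    finally show "prod_list (map w \<tau>) \<le> (\<Sum>i<3. prod_list (map w \<tau>) * light (map (coord i) \<tau>))" .
  qed
  also have "\<dots> = (\<Sum>i<3. \<Sum>\<tau>\<in>words m (triples N). prod_list (map w \<tau>) * light (map (coord i) \<tau>))"
    by (rule sum.swap)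
  also have "\<dots> = (\<Sum>i<(3::nat). \<Sum>xs\<in>words m {..N}. prod_list (map p xs) * light xs)"
    by (intro sum.cong refl sum_words_marginal marg) auto
  also have "\<dots> \<le> (\<Sum>i<(3::nat). (m + 1) ^ card {..N} * e)"
    unfolding light_def by (intro sum_mono light_words_weight) (use p e in auto)
  also have "\<dots> = 3 * ((real m + 1) ^ (N + 1) * e)" by (simp add: algebra_simps)
  finally show False using e by simp
qed

text \<open>
  Following a heavy word of triples by its two rotations gives a word of length \<open>3 * m\<close> whose coordinate
  words all have the type \<open>T 0 + T 1 + T 2\<close>. The total of the entries in such a coordinate word is exactly
  \<open>N * m\<close>, whence each word of this type has weight \<open>theta q ^ (- 3 * m)\<close> without any error term, and
  bounds on the weight of the type become bounds on its cardinality.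
\<close>
lemma exists_heavy_symmetric_type:
  assumes q: "q \<ge> 2"
  shows "\<exists>M. size M = 3 * m \<and> set_mset M \<subseteq> {..q-1} \<and>
    (\<exists>\<tau>\<in>words (3 * m) (triples (q - 1)). \<forall>i<3. mset (map (coord i) \<tau>) = M) \<and>
    real (card (permutations_of_multiset M)) \<le> theta q ^ (3 * m) \<and>
    theta q ^ (3 * m) \<le> real (card (permutations_of_multiset M)) * (4 * (real m + 1) ^ q) ^ 3"
proof -
  define N where "N = q - 1"
  have N: "N \<ge> 1" "q = N + 1" "{..<q} = {..N}" using q by (auto simp: N_def)
  obtain \<beta> where b: "0 < \<beta>" "\<beta> \<le> 1" "theta q = theta_fun q \<beta>"
    "(\<Sum>j\<le>N. \<beta> ^ j * (3 * real j - real N)) = 0"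
    by (rule theta_minimiser[OF q]) (simp only: N(3) flip: N_def)
  define Z where "Z = (\<Sum>j\<le>N. \<beta> ^ j)"
  have Z: "Z > 0" unfolding Z_def using b by (intro sum_pos) auto
  have theta: "theta q = Z * \<beta> powr (- (real N / 3))"
    unfolding b(3) theta_fun_def Z_def using N by simp
  define p where "p j = \<beta> ^ j / Z" for j
  have p: "\<And>x. 0 \<le> p x" "(\<Sum>x\<le>N. p x) = 1"
    using b Z by (auto simp: p_def Z_def simp flip: sum_divide_distrib)
  have "(\<Sum>x\<le>N. p x * (3 * real x - real N)) = 0"
    using b(4) by (simp add: p_def flip: sum_divide_distrib)
  moreover have "p (Suc k) \<le> p k" for k
    unfolding p_def using b Z by (intro divide_right_mono) (auto simp: mult_left_le_one_le)
  ultimately obtain w where w: "\<And>t. t \<in> triples N \<Longrightarrow> 0 \<le> w t"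
    "\<And>i h. i < 3 \<Longrightarrow> (\<Sum>t\<in>triples N. w t * h (coord i t)) = (\<Sum>x\<le>N. p x * h x)"
    using decreasing_coupling[OF N(1), of p] p(1) by blast
  define e where "e = 1 / (4 * (real m + 1) ^ q)"
  define Y where "Y = (4 * (real m + 1) ^ q) ^ 3"
  have e: "0 \<le> e" "4 * (real m + 1) ^ (N + 1) * e \<le> 1" by (auto simp: e_def N(2))
  obtain \<sigma> where \<sigma>: "\<sigma> \<in> words m (triples N)" "\<And>i. i < 3 \<Longrightarrow> e \<le> class_weight p (mset (map (coord i) \<sigma>))"
    using exists_heavy_triple_word[OF w p e] by blast
  define \<tau> where "\<tau> = \<sigma> @ map rot \<sigma> @ map (rot \<circ> rot) \<sigma>"
  define T where "T i = mset (map (coord i) \<sigma>)" for i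
  define M where "M = T 0 + T 1 + T 2"
  have c: "map (coord i) (map rot xs) = map (coord (if i = 2 then 0 else i + 1)) xs"
    "map (coord i) (map (rot \<circ> rot) xs) = map (coord (if i = 0 then 2 else i - 1)) xs" if "i < 3" for i xs
    using that by (auto simp: coord_def rot_def)
  have len: "length \<sigma> = m" and sub: "set \<sigma> \<subseteq> triples N" using \<sigma> by (auto simp: words_def)
  have \<tau>: "\<tau> \<in> words (3 * m) (triples N)"
    using len sub by (auto simp: \<tau>_def words_def rot_in_triples)
  have type: "mset (map (coord i) \<tau>) = M" if "i < 3" for i
  proof -
    have i: "i = 0 \<or> i = 1 \<or> i = 2" using that by auto
    show ?thesis
      unfolding \<tau>_def map_append mset_append c[OF that] M_def T_def
      using i by (elim disjE) (simp_all add: ac_simps numeral_2_eq_2)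
  qed
  have size: "size M = 3 * m" by (simp add: M_def T_def len)
  have range: "set_mset M \<subseteq> {..N}"
    using sub by (auto simp: M_def T_def intro: coord_le)
  have sumM: "sum_mset M = N * m"
  proof -
    have "sum_mset M = (\<Sum>t\<leftarrow>\<sigma>. coord 0 t + coord 1 t + coord 2 t)"
      unfolding M_def T_def sum_mset.union sum_mset_sum_list by (simp only: sum_list_addf)
    also have "\<dots> = (\<Sum>t\<leftarrow>\<sigma>. N)"
      using sub by (intro arg_cong[of _ _ sum_list] map_cong refl coord_sum) auto
    finally show ?thesis by (simp add: len sum_list_triv)
  qed
  have "prod_mset (image_mset p M) = \<beta> ^ sum_mset M / Z ^ size M" for M
    by (induction M) (simp_all add: p_def power_add)
  then have prod: "prod_mset (image_mset p M) = \<beta> ^ (N * m) / Z ^ (3 * m)"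
    by (simp add: size sumM)
  have theta3: "theta q ^ (3 * m) = Z ^ (3 * m) / \<beta> ^ (N * m)"
  proof -
    have "(\<beta> powr (- (real N / 3))) ^ (3 * m) = \<beta> powr (- real (N * m))"
      using b(1) by (simp add: powr_realpow[symmetric] powr_powr)
    also have "\<dots> = 1 / \<beta> ^ (N * m)"
      using b(1) by (simp only: powr_minus powr_realpow inverse_eq_divide)
    finally show ?thesis unfolding theta power_mult_distrib by simp
  qed
  have th0: "theta q ^ (3 * m) > 0" using theta_ge_1[OF q] by simp
  have cw: "class_weight p M = real (card (permutations_of_multiset M)) / theta q ^ (3 * m)"
    unfolding class_weight_def prod theta3 by simp
  have "class_weight p M \<le> 1"
    by (rule class_weight_le_1[OF _ _ p(2) range]) (use p in auto)
  then have upper: "real (card (permutations_of_multiset M)) \<le> theta q ^ (3 * m)"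
    unfolding cw using th0 by simp
  have "e * e * e \<le> class_weight p (T 0) * class_weight p (T 1) * class_weight p (T 2)"
    using \<sigma>(2)[of 0] \<sigma>(2)[of 1] \<sigma>(2)[of 2] e(1) by (intro mult_mono) (auto simp: T_def)
  also have "\<dots> \<le> class_weight p (T 0 + T 1) * class_weight p (T 2)"
  proof (intro mult_right_mono class_weight_mult p)
    show "0 \<le> class_weight p (T 2)" using \<sigma>(2)[of 2] e(1) by (simp add: T_def)
  qed
  also have "\<dots> \<le> class_weight p M"
    unfolding M_def by (intro class_weight_mult p)
  finally have "e ^ 3 * theta q ^ (3 * m) \<le> real (card (permutations_of_multiset M))"
    unfolding cw using th0 by (simp add: power3_eq_cube field_simps)
  moreover have "e * (4 * (real m + 1) ^ q) = 1" by (simp add: e_def)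
  then have "e ^ 3 * (4 * (real m + 1) ^ q) ^ 3 = 1"
    by (simp only: power_mult_distrib[symmetric] power_one)
  ultimately have inv: "e ^ 3 * Y = 1" and le: "e ^ 3 * theta q ^ (3 * m) \<le> real (card (permutations_of_multiset M))"
    by (simp_all only: Y_def)
  have "theta q ^ (3 * m) = e ^ 3 * theta q ^ (3 * m) * Y"
  proof -
    have "e ^ 3 * theta q ^ (3 * m) * Y = (e ^ 3 * Y) * theta q ^ (3 * m)" by (simp only: mult_ac)
    then show ?thesis by (simp only: inv mult_1_left)
  qed
  also have "\<dots> \<le> real (card (permutations_of_multiset M)) * Y"
    by (rule mult_right_mono[OF le]) (simp add: Y_def)
  finally have "theta q ^ (3 * m) \<le> real (card (permutations_of_multiset M)) * (4 * (real m + 1) ^ q) ^ 3"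
    by (simp only: Y_def)
  with upper \<tau> type size range show ?thesis
    unfolding N_def by blast
qed

section \<open>Behrend's progression-free sets\<close>

definition ap_free :: "nat set \<Rightarrow> bool" where
  "ap_free S \<longleftrightarrow> (\<forall>x\<in>S. \<forall>y\<in>S. \<forall>z\<in>S. x + y = 2 * z \<longrightarrow> x = y)"

text \<open>
  With digits below \<open>d\<close> in base \<open>2 * d\<close>, adding two numbers produces no carries.
\<close>
lemma digits_midpoint:
  fixes xs ys zs :: "nat list"
  assumes "length xs = length ys" "length ys = length zs"
    and "set xs \<subseteq> {..<d}" "set ys \<subseteq> {..<d}" "set zs \<subseteq> {..<d}"
    and "horner_sum (\<lambda>x. x) (2 * d) xs + horner_sum (\<lambda>x. x) (2 * d) ys = 2 * horner_sum (\<lambda>x. x) (2 * d) zs"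
  shows "map2 (+) xs ys = map ((*) 2) zs"
  using assms
proof (induction xs ys zs rule: list_induct3)
  case (Cons x xs y ys z zs)
  define X Y Z where "X = horner_sum (\<lambda>x. x) (2 * d) xs" and "Y = horner_sum (\<lambda>x. x) (2 * d) ys"
    and "Z = horner_sum (\<lambda>x. x) (2 * d) zs"
  have less: "x + y < 2 * d" "2 * z < 2 * d" using Cons.prems by auto
  have eq: "(x + y) + 2 * d * (X + Y) = 2 * z + 2 * d * (2 * Z)"
    using Cons.prems(4) unfolding horner_sum_simps X_def[symmetric] Y_def[symmetric] Z_def[symmetric]
    by (simp add: algebra_simps)
  then have "((x + y) + 2 * d * (X + Y)) mod (2 * d) = (2 * z + 2 * d * (2 * Z)) mod (2 * d)" by (rule arg_cong)
  then have "x + y = 2 * z" unfolding mod_mult_self2 using less by simp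
  moreover from this eq less have "X + Y = 2 * Z" by auto
  ultimately show ?case using Cons.IH Cons.prems by (simp add: X_def Y_def Z_def)
qed simp

lemma horner_sum_less:
  fixes xs :: "nat list"
  assumes "set xs \<subseteq> {..<b}"
  shows "horner_sum (\<lambda>x. x) b xs < b ^ length xs"
  using assms
proof (induction xs)
  case (Cons x xs)
  then have "x + b * horner_sum (\<lambda>x. x) b xs + 1 \<le> b + b * horner_sum (\<lambda>x. x) b xs" by simp
  also have "\<dots> = b * (horner_sum (\<lambda>x. x) b xs + 1)" by simp
  also have "\<dots> \<le> b * b ^ length xs" using Cons by (intro mult_left_mono) (auto simp: Suc_le_eq)
  finally show ?case by simp
qed simp

lemma parallelogram:
  fixes xs ys zs :: "nat list"
  assumes "length xs = length ys" "length ys = length zs" "map2 (+) xs ys = map ((*) 2) zs"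
  shows "(\<Sum>(x, y)\<leftarrow>zip xs ys. (int x - int y)\<^sup>2) + 4 * (\<Sum>z\<leftarrow>zs. (int z)\<^sup>2)
    = 2 * (\<Sum>x\<leftarrow>xs. (int x)\<^sup>2) + 2 * (\<Sum>y\<leftarrow>ys. (int y)\<^sup>2)"
  using assms
proof (induction xs ys zs rule: list_induct3)
  case (Cons x xs y ys z zs)
  then have "int x + int y = 2 * int z" by simp
  then have "(int x - int y)\<^sup>2 + 4 * (int z)\<^sup>2 = 2 * (int x)\<^sup>2 + 2 * (int y)\<^sup>2"
    by algebra
  then show ?case using Cons by (simp add: algebra_simps)
qed simp

lemma equal_norm_midpoint:
  fixes xs ys zs :: "nat list"
  assumes len: "length xs = length ys" "length ys = length zs" and mid: "map2 (+) xs ys = map ((*) 2) zs"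
    and norm: "(\<Sum>x\<leftarrow>xs. x\<^sup>2) = r" "(\<Sum>y\<leftarrow>ys. y\<^sup>2) = r" "(\<Sum>z\<leftarrow>zs. z\<^sup>2) = r"
  shows "xs = ys"
proof -
  have int: "(\<Sum>x\<leftarrow>xs. (int x)\<^sup>2) = int (\<Sum>x\<leftarrow>xs. x\<^sup>2)" for xs
    by (induction xs) auto
  have "(\<Sum>(x, y)\<leftarrow>zip xs ys. (int x - int y)\<^sup>2) = 0"
    using parallelogram[OF len mid] unfolding int norm by simp
  with len(1) show ?thesis
  proof (induction xs ys rule: list_induct2)
    case (Cons x xs y ys)
    have "0 \<le> (\<Sum>(x, y)\<leftarrow>zip xs ys. (int x - int y)\<^sup>2)" by (rule sum_list_nonneg) auto
    with Cons.prems have "(int x - int y)\<^sup>2 = 0" "(\<Sum>(x, y)\<leftarrow>zip xs ys. (int x - int y)\<^sup>2) = 0"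
      by (auto simp: add_nonneg_eq_0_iff)
    with Cons.IH show ?case by simp
  qed simp
qed

text \<open>
  Numbers whose digit vectors lie on a common sphere contain no three-term progression, as a sphere is
  strictly convex. There are at most \<open>k * d\<^sup>2\<close> spheres, so one of them carries the stated share of the
  \<open>d ^ k\<close> vectors.
\<close>
lemma behrend_sphere:
  assumes d: "d \<ge> 1" and k: "k \<ge> 1"
  shows "\<exists>S\<subseteq>{..<(2 * d) ^ k}. ap_free S \<and> d ^ k \<le> card S * (k * d\<^sup>2)"
proof -
  define W where "W = words k {..<d}"
  define nrm where "nrm xs = (\<Sum>x\<leftarrow>xs. x\<^sup>2)" for xs :: "nat list"
  define L where "L r = {xs\<in>W. nrm xs = r}" for r
  have finW: "finite W" by (simp add: W_def finite_words)
  have nrm: "nrm xs < k * d\<^sup>2" if "xs \<in> W" for xs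
  proof -
    have len: "length xs = k" and sub: "set xs \<subseteq> {..<d}" using that by (auto simp: W_def words_def)
    have "nrm xs \<le> (\<Sum>x\<leftarrow>xs. (d - 1)\<^sup>2)"
      unfolding nrm_def using sub by (intro sum_list_mono power_mono) auto
    also have "\<dots> = k * (d - 1)\<^sup>2" by (simp add: sum_list_triv len)
    also have "\<dots> < k * d\<^sup>2" using d k by (simp add: power_strict_mono)
    finally show ?thesis .
  qed
  have "\<exists>r. d ^ k \<le> card (L r) * (k * d\<^sup>2)"
  proof (rule ccontr)
    assume neg: "\<nexists>r. d ^ k \<le> card (L r) * (k * d\<^sup>2)"
    have "d ^ k = card W" by (simp add: W_def card_words)
    also have "\<dots> = (\<Sum>r<k * d\<^sup>2. card (L r))"
    proof -
      have "nrm ` W \<subseteq> {..<k * d\<^sup>2}" using nrm by auto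
      from sum.group[OF finW _ this, of "\<lambda>_. 1::nat"] show ?thesis by (simp add: L_def)
    qed
    finally have "d ^ k * (k * d\<^sup>2) = (\<Sum>r<k * d\<^sup>2. card (L r) * (k * d\<^sup>2))"
      by (simp add: sum_distrib_right)
    also have "\<dots> < (\<Sum>r<k * d\<^sup>2. d ^ k)"
      using neg d k by (intro sum_strict_mono) (auto simp: not_le lessThan_empty_iff)
    finally show False by simp
  qed
  then obtain r where r: "d ^ k \<le> card (L r) * (k * d\<^sup>2)" ..
  define val :: "nat list \<Rightarrow> nat" where "val = horner_sum (\<lambda>x. x) (2 * d)"
  have W: "length xs = k" "set xs \<subseteq> {..<d}" "nrm xs = r" if "xs \<in> L r" for xs
    using that by (auto simp: L_def W_def words_def)
  have "inj_on val (L r)"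
  proof (rule inj_onI)
    fix xs zs assume "xs \<in> L r" "zs \<in> L r" "val xs = val zs"
    then have "map2 (+) xs xs = map ((*) 2) zs"
      using W by (intro digits_midpoint[of _ _ _ d]) (auto simp: val_def)
    then show "xs = zs"
      using W[OF \<open>xs \<in> L r\<close>] W[OF \<open>zs \<in> L r\<close>] by (intro nth_equalityI) (auto dest: arg_cong[of _ _ "\<lambda>l. l ! _"] simp: list_eq_iff_nth_eq)
  qed
  then have "card (val ` L r) = card (L r)" by (rule card_image)
  moreover have "val ` L r \<subseteq> {..<(2 * d) ^ k}"
  proof safe
    fix xs assume "xs \<in> L r"
    then have "set xs \<subseteq> {..<2 * d}" "length xs = k" using W by force+
    then show "val xs < (2 * d) ^ k" unfolding val_def by (metis horner_sum_less)
  qed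
  moreover have "ap_free (val ` L r)"
    unfolding ap_free_def
  proof (intro ballI impI)
    fix x y z assume "x \<in> val ` L r" "y \<in> val ` L r" "z \<in> val ` L r" and eq: "x + y = 2 * z"
    then obtain xs ys zs where l: "xs \<in> L r" "ys \<in> L r" "zs \<in> L r" and v: "x = val xs" "y = val ys" "z = val zs"
      by blast
    have "xs = ys"
    proof (rule equal_norm_midpoint)
      show "map2 (+) xs ys = map ((*) 2) zs"
        using l W eq v by (intro digits_midpoint[of _ _ _ d]) (auto simp: val_def)
    qed (use W l in \<open>auto simp: nrm_def\<close>)
    then show "x = y" by (simp add: v)
  qed
  ultimately show ?thesis using r by metis
qed

text \<open>
  With \<open>L = ln M\<close>, the number \<open>k\<close> of digits costs a factor \<open>2 ^ k\<close> for avoiding carries and a factor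
  \<open>d\<^sup>2\<close>, roughly \<open>exp (2 * L / k)\<close>, for the number of spheres. The value \<open>\<kappa> = sqrt (2 * L / ln 2)\<close>
  balances the exponents \<open>k * ln 2\<close> and \<open>2 * L / k\<close>, each then being \<open>sqrt (2 * ln 2 * L)\<close>. Rounding \<open>k\<close> and \<open>d\<close>
  costs bounded factors; for \<open>d\<close> this is Bernoulli's inequality together with the assumption, which gives
  \<open>M powr (1 / k) \<ge> 4 * k\<close>.
\<close>
lemma behrend_large:
  fixes M :: nat
  defines "L \<equiv> ln (real M)"
  assumes M: "M \<ge> 2" and big: "ln (4 * (sqrt (2 * L / ln 2) + 1)) \<le> L / (sqrt (2 * L / ln 2) + 1)"
  shows "\<exists>S\<subseteq>{..<M}. ap_free S \<and> M * exp (- 2 * sqrt (2 * ln 2 * L)) / (2 * (sqrt L + 1)) \<le> card S"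
proof -
  have L: "L > 0" using M by (simp add: L_def)
  define \<kappa> where "\<kappa> = sqrt (2 * L / ln 2)"
  have \<kappa>: "\<kappa> > 0" using L by (simp add: \<kappa>_def)
  define k where "k = nat \<lceil>\<kappa>\<rceil>"
  have k: "\<kappa> \<le> k" "k \<le> \<kappa> + 1" "k \<ge> 1"
    using \<kappa> ceiling_correct[of \<kappa>] by (auto simp: k_def le_nat_iff)
  define y where "y = exp (L / k)"
  have yk: "y ^ k = M" using M k(3) by (simp add: y_def L_def flip: exp_of_nat_mult)
  have y4: "4 * real k \<le> y"
  proof -
    have "4 * real k \<le> 4 * (\<kappa> + 1)" using k by simp
    also have "\<dots> = exp (ln (4 * (\<kappa> + 1)))" using \<kappa> by simp
    also have "\<dots> \<le> exp (L / (\<kappa> + 1))" using big by (simp add: \<kappa>_def)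
    also have "\<dots> \<le> y" unfolding y_def using k L \<kappa> by (auto intro!: divide_left_mono)
    finally show ?thesis .
  qed
  have y0: "y \<ge> 4" using y4 k(3) by linarith
  define d where "d = nat \<lfloor>y / 2\<rfloor>"
  have d: "real d \<le> y / 2" "y / 2 - 1 \<le> real d" "d \<ge> 1"
  proof -
    have "real d = of_int \<lfloor>y / 2\<rfloor>" using y0 by (simp add: d_def)
    then show "real d \<le> y / 2" and *: "y / 2 - 1 \<le> real d"
      using of_int_floor_le[of "y / 2"] real_of_int_floor_add_one_gt[of "y / 2"] by linarith+
    have "1 \<le> real d" using * y0 by linarith
    then show "d \<ge> 1" by simp
  qed
  obtain S where S: "S \<subseteq> {..<(2 * d) ^ k}" "ap_free S" "d ^ k \<le> card S * (k * d\<^sup>2)"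
    using behrend_sphere[OF d(3) k(3)] by blast
  have "real ((2 * d) ^ k) \<le> y ^ k" unfolding of_nat_power using d by (intro power_mono) auto
  then have "(2 * d) ^ k \<le> M" using yk by (simp only: of_nat_le_iff)
  then have sub: "S \<subseteq> {..<M}" using S(1) by auto
  have "real M / 2 ^ k / 2 \<le> (y / 2) ^ k * (1 - 2 * real k / y)"
  proof -
    have "1 / 2 \<le> 1 - 2 * real k / y" using y4 y0 by (simp add: field_simps)
    then have "(y / 2) ^ k * (1 / 2) \<le> (y / 2) ^ k * (1 - 2 * real k / y)" using y0 by (intro mult_left_mono) auto
    then show ?thesis by (simp add: power_divide yk)
  qed
  also have "\<dots> \<le> (y / 2) ^ k * (1 - 2 / y) ^ k"
  proof (intro mult_left_mono)
    have "1 + real k * (- 2 / y) \<le> (1 + (- 2 / y)) ^ k"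
      using y0 by (intro Bernoulli_inequality) (simp add: field_simps)
    then show "1 - 2 * real k / y \<le> (1 - 2 / y) ^ k" by (simp add: mult.commute)
  qed (use y0 in auto)
  also have "\<dots> = (y / 2 - 1) ^ k"
  proof -
    have "y / 2 * (1 - 2 / y) = y / 2 - 1" using y0 by (simp add: field_simps)
    then show ?thesis by (simp only: power_mult_distrib[symmetric])
  qed
  also have "\<dots> \<le> real d ^ k" using d y0 by (intro power_mono) auto
  also have "\<dots> \<le> card S * (k * (real d)\<^sup>2)"
    using S(3) by (simp flip: of_nat_power of_nat_mult)
  also have "\<dots> \<le> card S * ((\<kappa> + 1) * (y / 2)\<^sup>2)"
    using d k by (intro mult_left_mono mult_mono power_mono) auto
  finally have main: "M / 2 ^ k / 2 \<le> card S * ((\<kappa> + 1) * (y / 2)\<^sup>2)" .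
  define E where "E = sqrt (2 * ln 2 * L)"
  have E: "\<kappa> * ln 2 = E" "2 * L / \<kappa> = E"
  proof -
    have "E * E = 2 * ln 2 * L" using L by (simp add: E_def)
    have kk: "\<kappa> * \<kappa> = 2 * L / ln 2" using L by (simp add: \<kappa>_def)
    have "(\<kappa> * ln 2)\<^sup>2 = 2 * ln 2 * L"
      using kk by (simp add: power2_eq_square field_simps)
    then show e: "\<kappa> * ln 2 = E" unfolding E_def using \<kappa> by (intro real_sqrt_unique[symmetric]) auto
    show "2 * L / \<kappa> = E" using kk \<kappa> unfolding e[symmetric] by (simp add: field_simps)
  qed
  have two: "2 ^ k \<le> 2 * exp E"
  proof -
    have "(2::real) ^ k = 2 powr k" by (simp add: powr_realpow)
    also have "\<dots> \<le> 2 powr (\<kappa> + 1)" using k by (intro powr_mono) auto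
    also have "\<dots> = 2 * 2 powr \<kappa>" by (simp add: powr_add)
    also have "2 powr \<kappa> = exp E" by (simp add: powr_def E(1))
    finally show ?thesis .
  qed
  have ysq: "y\<^sup>2 \<le> exp E"
  proof -
    have "y\<^sup>2 = exp (2 * L / k)" by (simp add: y_def power2_eq_square flip: exp_add)
    also have "\<dots> \<le> exp (2 * L / \<kappa>)" using k L \<kappa> by (auto intro!: divide_left_mono)
    finally show ?thesis by (simp add: E(2))
  qed
  have kap: "\<kappa> + 1 \<le> 2 * (sqrt L + 1)"
  proof -
    have "1 / 2 \<le> ln (2::real)" using ln_add_one_self_le_self2[of "-1/2"] by (simp add: ln_div)
    then have "2 * L / ln 2 \<le> 4 * L" using L by (simp add: field_simps)
    then have "\<kappa> \<le> sqrt (4 * L)" unfolding \<kappa>_def by (rule real_sqrt_le_mono)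
    then show ?thesis by (simp add: real_sqrt_mult)
  qed
  have "M * exp (- 2 * E) / (2 * (sqrt L + 1)) = M / (exp E * exp E * (2 * (sqrt L + 1)))"
    by (simp add: exp_minus field_simps flip: exp_add)
  also have "\<dots> \<le> M / (2 ^ k / 2 * y\<^sup>2 * (\<kappa> + 1))"
    using two ysq kap \<kappa> y0 by (intro divide_left_mono mult_mono mult_pos_pos) auto
  also have "\<dots> \<le> card S"
  proof (subst pos_divide_le_eq)
    show "0 < 2 ^ k / 2 * y\<^sup>2 * (\<kappa> + 1)" using \<kappa> y0 by simp
    show "real M \<le> card S * (2 ^ k / 2 * y\<^sup>2 * (\<kappa> + 1))"
      using mult_right_mono[OF main, of "2 * 2 ^ k"] by (simp add: power_divide mult_ac)
  qed
  finally show ?thesis using sub S(2) unfolding E_def by blast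
qed

text \<open>
  Small \<open>M\<close> are absorbed into the constant \<open>c\<close> by taking \<open>S = {0}\<close>.
\<close>
lemma behrend:
  "\<exists>c>0. \<forall>M\<ge>1. \<exists>S\<subseteq>{..<M}. ap_free S \<and>
    c * real M * exp (- 2 * sqrt (2 * ln 2 * ln (real M))) / (sqrt (ln (real M)) + 1) \<le> real (card S)"
proof -
  have "eventually (\<lambda>L. ln (4 * (sqrt (2 * L / ln 2) + 1)) \<le> L / (sqrt (2 * L / ln 2) + 1)) at_top"
    by real_asymp
  then have "eventually (\<lambda>M::nat. ln (4 * (sqrt (2 * ln (real M) / ln 2) + 1))
      \<le> ln (real M) / (sqrt (2 * ln (real M) / ln 2) + 1)) sequentially"
    by (rule eventually_compose_filterlim) real_asymp
  then obtain M0 :: nat where M0: "\<And>M. M \<ge> M0 \<Longrightarrow> ln (4 * (sqrt (2 * ln (real M) / ln 2) + 1))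
      \<le> ln (real M) / (sqrt (2 * ln (real M) / ln 2) + 1)"
    unfolding eventually_sequentially by blast
  define c where "c = 1 / (real M0 + 2)"
  have c: "0 < c" "c \<le> 1 / 2" by (auto simp: c_def field_simps)
  have "\<exists>S\<subseteq>{..<M}. ap_free S \<and>
    c * real M * exp (- 2 * sqrt (2 * ln 2 * ln (real M))) / (sqrt (ln (real M)) + 1) \<le> real (card S)"
    if M: "M \<ge> 1" for M :: nat
  proof (cases "M \<ge> M0 \<and> M \<ge> 2")
    case True
    then obtain S where S: "S \<subseteq> {..<M}" "ap_free S"
      "M * exp (- 2 * sqrt (2 * ln 2 * ln M)) / (2 * (sqrt (ln M) + 1)) \<le> card S"
      using behrend_large[of M] M0[of M] by auto
    have "c * real M * exp (- 2 * sqrt (2 * ln 2 * ln M)) / (sqrt (ln M) + 1)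
        \<le> (1 / 2) * real M * exp (- 2 * sqrt (2 * ln 2 * ln M)) / (sqrt (ln M) + 1)"
      using c M by (intro divide_right_mono mult_right_mono) auto
    also have "\<dots> = M * exp (- 2 * sqrt (2 * ln 2 * ln M)) / (2 * (sqrt (ln M) + 1))"
      by (simp only: divide_simps) simp
    also note S(3)
    finally show ?thesis using S(1,2) by blast
  next
    case False
    then have "real M \<le> real M0 + 2" by auto
    then have "c * real M \<le> 1" by (simp add: c_def field_simps)
    moreover have "exp (- 2 * sqrt (2 * ln 2 * ln (real M))) \<le> 1" using M by simp
    ultimately have "c * real M * exp (- 2 * sqrt (2 * ln 2 * ln (real M))) \<le> 1"
      by (metis exp_ge_zero mult_le_one)
    moreover have "sqrt (ln (real M)) + 1 \<ge> 1" using M by simp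
    ultimately have "c * real M * exp (- 2 * sqrt (2 * ln 2 * ln (real M))) / (sqrt (ln (real M)) + 1) \<le> 1"
      by (subst divide_le_eq_1_pos; linarith)
    then show ?thesis using M by (intro exI[of _ "{0}"]) (auto simp: ap_free_def)
  qed
  with c(1) show ?thesis by blast
qed

section \<open>Linear hash functions and isolated triples\<close>

definition dot :: "int list \<Rightarrow> nat list \<Rightarrow> int" where
  "dot u xs = (\<Sum>(s, x)\<leftarrow>zip u xs. s * int x)"

lemma dot_simps [simp]: "dot [] xs = 0" "dot u [] = 0" "dot (s # u) (x # xs) = s * int x + dot u xs"
  by (simp_all add: dot_def)

lemma residue_eqI:
  fixes s s' :: int
  assumes "s \<in> {0..<int P}" "s' \<in> {0..<int P}" "int P dvd s - s'"
  shows "s = s'"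
  using assms by (metis atLeastLessThan_iff mod_eq_dvd_iff mod_pos_pos_trivial)

text \<open>
  Two distinct words collide under a random linear form modulo \<open>P\<close> with probability at most \<open>1 / P\<close>: at the
  first position where they differ, the coefficient is determined by the others. Dividing by the
  difference of the letters is possible because \<open>P\<close> is coprime to all such differences.
\<close>
lemma dot_collisions:
  fixes P :: nat
  assumes "length xs = length ys" "xs \<noteq> ys" "set xs \<subseteq> {..N}" "set ys \<subseteq> {..N}"
    and cop: "\<And>d. d \<noteq> 0 \<Longrightarrow> \<bar>d\<bar> \<le> int N \<Longrightarrow> coprime d (int P)"
  shows "card {u \<in> words (length xs) {0..<int P}. int P dvd dot u xs - dot u ys} * P \<le> P ^ length xs"
  using assms(1-4)
proof (induction xs ys rule: list_induct2)
  case (Cons x xs y ys)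
  define Z where "Z = {0..<int P}"
  have Z: "finite Z" "card Z = P" by (simp_all add: Z_def)
  define n where "n = length xs"
  define A where "A = {u \<in> words (Suc n) Z. int P dvd dot u (x # xs) - dot u (y # ys)}"
  have "card A * P \<le> P ^ Suc n"
  proof (cases "x = y")
    case True
    define B where "B = {u \<in> words n Z. int P dvd dot u xs - dot u ys}"
    have IH: "card B * P \<le> P ^ n"
      using Cons True unfolding B_def Z_def n_def by auto
    have "A = (\<lambda>(s, u). s # u) ` (Z \<times> B)"
      using True by (auto simp: A_def B_def words_Suc)
    then have "card A \<le> card (Z \<times> B)"
    proof (elim ssubst)
      have "finite B" using Z by (simp add: B_def finite_words)
      then show "card ((\<lambda>(s, u). s # u) ` (Z \<times> B)) \<le> card (Z \<times> B)"
        using Z by (intro card_image_le) simp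
    qed
    then have "card A \<le> P * card B" using Z by (simp add: card_cartesian_product)
    then have "card A * P \<le> P * card B * P" by (rule mult_le_mono1)
    also have "\<dots> = P * (card B * P)" by (simp only: mult.assoc)
    also have "\<dots> \<le> P * P ^ n" using IH by (rule mult_le_mono2)
    finally show ?thesis by simp
  next
    case False
    have "inj_on tl A"
    proof (rule inj_onI)
      fix u u' assume "u \<in> A" "u' \<in> A" "tl u = tl u'"
      then obtain s s' t where u: "u = s # t" "u' = s' # t" and s: "s \<in> Z" "s' \<in> Z"
        by (auto simp: A_def words_Suc)
      have "int P dvd (dot u (x # xs) - dot u (y # ys)) - (dot u' (x # xs) - dot u' (y # ys))"
        by (rule dvd_diff) (use \<open>u \<in> A\<close> \<open>u' \<in> A\<close> in \<open>simp_all add: A_def\<close>)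
      also have "(dot u (x # xs) - dot u (y # ys)) - (dot u' (x # xs) - dot u' (y # ys))
          = (int x - int y) * (s - s')" by (simp add: u algebra_simps)
      finally have "int P dvd (int x - int y) * (s - s')" .
      moreover have "coprime (int P) (int x - int y)"
        using False Cons.prems by (subst coprime_commute, intro cop) auto
      ultimately have "int P dvd s - s'" by (metis coprime_dvd_mult_right_iff)
      with s show "u = u'" unfolding u Z_def by (metis residue_eqI)
    qed
    moreover have "tl ` A \<subseteq> words n Z" by (auto simp: A_def words_Suc)
    ultimately have "card A \<le> card (words n Z)"
      using Z by (intro card_inj_on_le[of tl]) (auto simp: finite_words)
    then show ?thesis using Z by (simp add: card_words mult.commute)
  qed
  then show ?case by (simp add: A_def n_def Z_def)
qed simp

lemma dot_triples:
  assumes "set \<tau> \<subseteq> triples N"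
  shows "dot u (map (coord 0) \<tau>) + dot u (map (coord 1) \<tau>) + dot u (map (coord 2) \<tau>) = dot u (map (\<lambda>_. N) \<tau>)"
  using assms
proof (induction \<tau> arbitrary: u)
  case (Cons t \<tau>)
  show ?case
  proof (cases u)
    case (Cons s u')
    have "int N = int (coord 0 t) + int (coord 1 t) + int (coord 2 t)"
      using coord_sum[of t N] Cons.prems by auto
    with Cons Cons.IH[of u'] Cons.prems show ?thesis by (simp add: algebra_simps)
  qed simp
qed simp

lemma triple_word_eqI:
  assumes "\<tau> \<in> words n (triples N)" "\<tau>' \<in> words n (triples N)"
    and "i < 3" "j < 3" "i \<noteq> j" "map (coord i) \<tau> = map (coord i) \<tau>'" "map (coord j) \<tau> = map (coord j) \<tau>'"
  shows "\<tau> = \<tau>'"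
proof (rule nth_equalityI)
  show len: "length \<tau> = length \<tau>'" using assms by (simp add: words_def)
  fix k assume k: "k < length \<tau>"
  have eq: "coord i (\<tau> ! k) = coord i (\<tau>' ! k)" "coord j (\<tau> ! k) = coord j (\<tau>' ! k)"
    using assms(6,7) k len by (metis nth_map)+
  have "\<tau> ! k \<in> triples N" "\<tau>' ! k \<in> triples N"
    using assms(1,2) k len by (metis (mono_tags, lifting) mem_Collect_eq nth_mem subsetD words_def)+
  then show "\<tau> ! k = \<tau>' ! k"
    using eq assms(3-5) by (auto simp: triples_def coord_def less_Suc_eq numeral_3_eq_3 split: if_splits)
qed

text \<open>
  First moment method with deletion. Of the kept elements only those are retained that conflict with no
  other kept element; their number is at least the number of kept elements minus the number of ordered
  conflicting pairs of kept elements. Both are averaged over \<open>\<Omega>\<close>.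
\<close>
lemma exists_good_choice:
  fixes k1 k2 m :: real
  assumes fin: "finite \<Omega>" "\<Omega> \<noteq> {}" "finite \<Theta>"
    and keep1: "\<And>t. t \<in> \<Theta> \<Longrightarrow> k1 \<le> card {w \<in> \<Omega>. keep w t}"
    and keep2: "\<And>t t'. t \<in> \<Theta> \<Longrightarrow> t' \<in> \<Theta> \<Longrightarrow> conf t t' \<Longrightarrow> t' \<noteq> t \<Longrightarrow> card {w \<in> \<Omega>. keep w t \<and> keep w t'} \<le> k2"
    and conf: "\<And>t. t \<in> \<Theta> \<Longrightarrow> card {t' \<in> \<Theta>. conf t t' \<and> t' \<noteq> t} \<le> m" and k2: "k2 \<ge> 0"
  shows "\<exists>w\<in>\<Omega>. card \<Theta> * (k1 - m * k2)
    \<le> card \<Omega> * real (card {t \<in> \<Theta>. keep w t \<and> (\<forall>t'\<in>\<Theta>. keep w t' \<and> conf t t' \<longrightarrow> t' = t)})"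
proof (rule ccontr)
  define C where "C t = {t' \<in> \<Theta>. conf t t' \<and> t' \<noteq> t}" for t
  define I where "I w = {t \<in> \<Theta>. keep w t \<and> (\<forall>t'\<in>\<Theta>. keep w t' \<and> conf t t' \<longrightarrow> t' = t)}" for w
  have finC: "finite (C t)" for t using fin by (simp add: C_def)
  assume "\<not> ?thesis"
  then have less: "card \<Omega> * real (card (I w)) < card \<Theta> * (k1 - m * k2)" if "w \<in> \<Omega>" for w
    using that unfolding I_def by (meson not_le)
  have count: "real (card {x \<in> A. Q x}) = (\<Sum>x\<in>A. of_bool (Q x))" if "finite A" for A and Q :: "'z \<Rightarrow> bool"
    using that by (simp add: Int_def flip: of_nat_sum)
  have iso: "(\<Sum>t\<in>\<Theta>. of_bool (keep w t) - (\<Sum>t'\<in>C t. of_bool (keep w t \<and> keep w t'))) \<le> real (card (I w))" for w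
    unfolding I_def count[OF fin(3)]
  proof (rule sum_mono)
    fix t assume t: "t \<in> \<Theta>"
    have nn: "0 \<le> (\<Sum>t'\<in>C t. of_bool (keep w t \<and> keep w t') :: real)" by (rule sum_nonneg) auto
    show "of_bool (keep w t) - (\<Sum>t'\<in>C t. of_bool (keep w t \<and> keep w t'))
      \<le> (of_bool (keep w t \<and> (\<forall>t'\<in>\<Theta>. keep w t' \<and> conf t t' \<longrightarrow> t' = t)) :: real)"
    proof (cases "keep w t \<and> (\<exists>t'\<in>\<Theta>. keep w t' \<and> conf t t' \<and> t' \<noteq> t)")
      case True
      then obtain t' where t': "t' \<in> C t" "keep w t'" by (auto simp: C_def)
      have "of_bool (keep w t \<and> keep w t') \<le> (\<Sum>t'\<in>C t. of_bool (keep w t \<and> keep w t') :: real)"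
        by (rule member_le_sum) (use t' finC in auto)
      then show ?thesis using True t' by simp
    next
      case False
      then have "of_bool (keep w t) = (of_bool (keep w t \<and> (\<forall>t'\<in>\<Theta>. keep w t' \<and> conf t t' \<longrightarrow> t' = t)) :: real)"
        by auto
      then show ?thesis using nn by linarith
    qed
  qed
  have "card \<Theta> * (k1 - m * k2) = (\<Sum>t\<in>\<Theta>. k1 - m * k2)" by simp
  also have "\<dots> \<le> (\<Sum>t\<in>\<Theta>. card {w \<in> \<Omega>. keep w t} - (\<Sum>t'\<in>C t. real (card {w \<in> \<Omega>. keep w t \<and> keep w t'})))"
  proof (intro sum_mono diff_mono keep1)
    fix t assume t: "t \<in> \<Theta>"
    have "(\<Sum>t'\<in>C t. real (card {w \<in> \<Omega>. keep w t \<and> keep w t'})) \<le> (\<Sum>t'\<in>C t. k2)"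
      using t by (intro sum_mono keep2) (auto simp: C_def)
    also have "\<dots> \<le> m * k2" using conf[OF t] k2 by (auto simp: C_def intro: mult_right_mono)
    finally show "(\<Sum>t'\<in>C t. real (card {w \<in> \<Omega>. keep w t \<and> keep w t'})) \<le> m * k2" .
  qed
  also have "\<dots> = (\<Sum>t\<in>\<Theta>. \<Sum>w\<in>\<Omega>. of_bool (keep w t) - (\<Sum>t'\<in>C t. of_bool (keep w t \<and> keep w t')))"
    unfolding count[OF fin(1)] sum_subtractf by (subst (2) sum.swap) (rule refl)
  also have "\<dots> = (\<Sum>w\<in>\<Omega>. \<Sum>t\<in>\<Theta>. of_bool (keep w t) - (\<Sum>t'\<in>C t. of_bool (keep w t \<and> keep w t')))"
    by (rule sum.swap)
  also have "\<dots> \<le> (\<Sum>w\<in>\<Omega>. real (card (I w)))" by (intro sum_mono iso)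
  finally have "card \<Omega> * (card \<Theta> * (k1 - m * k2)) \<le> (\<Sum>w\<in>\<Omega>. card \<Omega> * real (card (I w)))"
    by (simp add: mult_left_mono flip: sum_distrib_left)
  also have "\<dots> < (\<Sum>w\<in>\<Omega>. card \<Theta> * (k1 - m * k2))"
    using fin less by (intro sum_strict_mono) auto
  finally show False by simp
qed

text \<open>
  Words of triples whose three coordinate words all have type \<open>M\<close>, that is, the triples of words of type
  \<open>M\<close> with sum \<open>N\<close> in every position.
\<close>
definition triple_words :: "nat \<Rightarrow> nat \<Rightarrow> nat multiset \<Rightarrow> (nat \<times> nat \<times> nat) list set" where
  "triple_words n N M = {\<tau> \<in> words n (triples N). \<forall>i<3. mset (map (coord i) \<tau>) = M}"

lemma finite_triple_words: "finite (triple_words n N M)"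
  by (simp add: triple_words_def finite_words finite_triples)

text \<open>
  A permutation of positions carrying \<open>xs\<close> to \<open>ys\<close> carries triples through \<open>xs\<close> to triples through \<open>ys\<close>.
\<close>
lemma card_fibre_le:
  assumes xs: "xs \<in> permutations_of_multiset M" and ys: "ys \<in> permutations_of_multiset M"
  shows "card {\<tau> \<in> triple_words n N M. map (coord i) \<tau> = xs} \<le> card {\<tau> \<in> triple_words n N M. map (coord i) \<tau> = ys}"
    (is "card ?A \<le> card ?B")
proof -
  have "mset ys = mset xs" using xs ys by (simp add: permutations_of_multiset_def)
  then obtain p where p: "p permutes {..<length xs}" "permute_list p xs = ys"
    by (rule mset_eq_permutation)
  have len: "length \<tau> = length xs" if "\<tau> \<in> ?A" for \<tau>
    using that by auto
  show ?thesis
  proof (rule card_inj_on_le[of "permute_list p"])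
    show "inj_on (permute_list p) ?A"
    proof (rule inj_on_inverseI[of _ "permute_list (inv_into UNIV p)"])
      fix \<tau> assume "\<tau> \<in> ?A"
      have "permute_list (inv_into UNIV p) (permute_list p \<tau>) = permute_list (p \<circ> inv_into UNIV p) \<tau>"
        using permutes_inv[OF p(1)] len[OF \<open>\<tau> \<in> ?A\<close>] by (simp add: permute_list_compose)
      then show "permute_list (inv_into UNIV p) (permute_list p \<tau>) = \<tau>"
        using permutes_inv_o(1)[OF p(1)] by simp
    qed
    show "permute_list p ` ?A \<subseteq> ?B"
    proof (rule image_subsetI)
      fix \<tau> assume \<tau>: "\<tau> \<in> ?A"
      then have q: "p permutes {..<length \<tau>}" using p len by simp
      have "map (coord j) (permute_list p \<tau>) = permute_list p (map (coord j) \<tau>)" for j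
        using q by (rule permute_list_map[symmetric])
      then show "permute_list p \<tau> \<in> ?B"
        using \<tau> q p(2) by (simp add: triple_words_def words_def)
    qed
  qed (simp add: finite_triple_words)
qed

lemma card_fibre:
  assumes i: "i < 3" and xs: "xs \<in> permutations_of_multiset M"
  shows "card (triple_words n N M)
    = card (permutations_of_multiset M) * card {\<tau> \<in> triple_words n N M. map (coord i) \<tau> = xs}"
proof -
  define f where "f ys = card {\<tau> \<in> triple_words n N M. map (coord i) \<tau> = ys}" for ys
  have "(\<lambda>\<tau>. map (coord i) \<tau>) ` triple_words n N M \<subseteq> permutations_of_multiset M"
    using i by (auto simp: triple_words_def permutations_of_multiset_def)
  from sum.group[OF finite_triple_words _ this, of "\<lambda>_. 1::nat"]
  have "card (triple_words n N M) = (\<Sum>ys\<in>permutations_of_multiset M. f ys)"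
    by (simp add: f_def)
  also have "\<dots> = (\<Sum>ys\<in>permutations_of_multiset M. f xs)"
    using xs unfolding f_def by (intro sum.cong refl antisym card_fibre_le)
  finally show ?thesis by (simp add: f_def)
qed

text \<open>
  By symmetry every word of type \<open>M\<close> lies in equally many triples, in each of the three coordinates; the
  number is the same for all coordinates because the three types coincide. It is at most the number of
  words, since two members of a triple determine the third.
\<close>
lemma common_fibre_card:
  assumes "triple_words n N M \<noteq> {}"
  shows "\<exists>D. card (triple_words n N M) = card (permutations_of_multiset M) * D \<and>
    1 \<le> D \<and> D \<le> card (permutations_of_multiset M) \<and>
    (\<forall>i<3. \<forall>\<tau>\<in>triple_words n N M.
      card {\<tau>' \<in> triple_words n N M. map (coord i) \<tau>' = map (coord i) \<tau>} = D)"
proof -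
  obtain \<tau>0 where t0: "\<tau>0 \<in> triple_words n N M" using assms by blast
  define D where "D = card {\<tau> \<in> triple_words n N M. map (coord 0) \<tau> = map (coord 0) \<tau>0}"
  have cls: "map (coord i) \<tau> \<in> permutations_of_multiset M" if "i < 3" "\<tau> \<in> triple_words n N M" for i \<tau>
    using that by (auto simp: triple_words_def permutations_of_multiset_def)
  have W: "card (permutations_of_multiset M) > 0"
    using cls[OF _ t0, of 0] by (auto simp: card_gt_0_iff)
  have card: "card (triple_words n N M) = card (permutations_of_multiset M) * D"
    unfolding D_def by (rule card_fibre) (use cls t0 in auto)
  have "card (triple_words n N M) > 0" using assms by (simp add: card_gt_0_iff finite_triple_words)
  then have D1: "1 \<le> D" using card by (cases D) auto
  have fib: "card {\<tau>' \<in> triple_words n N M. map (coord i) \<tau>' = map (coord i) \<tau>} = D"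
    if "i < 3" "\<tau> \<in> triple_words n N M" for i \<tau>
    using card_fibre[OF that(1) cls[OF that], of n N] card W by simp
  have "D \<le> card (permutations_of_multiset M)"
    unfolding D_def
  proof (rule card_inj_on_le[of "map (coord 1)"])
    show "inj_on (map (coord 1)) {\<tau> \<in> triple_words n N M. map (coord 0) \<tau> = map (coord 0) \<tau>0}"
    proof (rule inj_onI)
      fix \<tau> \<tau>' assume *: "\<tau> \<in> {\<tau> \<in> triple_words n N M. map (coord 0) \<tau> = map (coord 0) \<tau>0}"
        "\<tau>' \<in> {\<tau> \<in> triple_words n N M. map (coord 0) \<tau> = map (coord 0) \<tau>0}"
        "map (coord 1) \<tau> = map (coord 1) \<tau>'"
      show "\<tau> = \<tau>'"
        by (rule triple_word_eqI[of _ n N _ 0 1]) (use * in \<open>auto simp: triple_words_def\<close>)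
    qed
    show "map (coord 1) ` {\<tau> \<in> triple_words n N M. map (coord 0) \<tau> = map (coord 0) \<tau>0} \<subseteq> permutations_of_multiset M"
      using cls by auto
  qed simp
  with card D1 fib show ?thesis by blast
qed

text \<open>
  The three affine maps are chosen such that the hash values \<open>x\<close>, \<open>y\<close>, \<open>z\<close> of the words of a triple satisfy
  \<open>x + y = 2 * z\<close> modulo \<open>P\<close>. The common linear part \<open>u\<close> and the two shifts
  \<open>s\<close> and \<open>v\<close> are random; the factor \<open>2\<close> in the first two maps avoids halving modulo \<open>P\<close>.
\<close>
definition hash :: "nat \<Rightarrow> nat \<Rightarrow> int list \<times> int \<times> int \<Rightarrow> nat \<Rightarrow> nat list \<Rightarrow> int" where
  "hash P N \<omega> i x = (case \<omega> of (u, s, v) \<Rightarrow>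
    (if i = 0 then 2 * dot u x + s
     else if i = 1 then 2 * dot u x + 2 * v - s
     else dot u (map (\<lambda>_. N) x) - dot u x + v) mod int P)"

definition kept :: "nat \<Rightarrow> nat \<Rightarrow> nat set \<Rightarrow> int list \<times> int \<times> int \<Rightarrow> (nat \<times> nat \<times> nat) list \<Rightarrow> bool" where
  "kept P N S \<omega> \<tau> \<longleftrightarrow> (\<forall>i<3. hash P N \<omega> i (map (coord i) \<tau>) \<in> int ` S)"

text \<open>
  The elements of \<open>S\<close> are below half of \<open>P\<close>, so the congruence \<open>x + y = 2 * z\<close> modulo \<open>P\<close> is an equation of
  integers.
\<close>
lemma kept_common_hash:
  assumes P: "odd P" "S \<subseteq> {..<(P + 1) div 2}" "ap_free S"
    and \<tau>: "set \<tau> \<subseteq> triples N" and keep: "kept P N S \<omega> \<tau>"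
  shows "\<exists>\<sigma>\<in>S. \<forall>i<3. hash P N \<omega> i (map (coord i) \<tau>) = int \<sigma>"
proof -
  obtain u s v where w: "\<omega> = (u, s, v)" by (cases \<omega>)
  define A where "A = 2 * dot u (map (coord 0) \<tau>) + s"
  define B where "B = 2 * dot u (map (coord 1) \<tau>) + 2 * v - s"
  define C where "C = dot u (map (\<lambda>_. N) \<tau>) - dot u (map (coord 2) \<tau>) + v"
  have h: "hash P N \<omega> 0 (map (coord 0) \<tau>) = A mod int P" "hash P N \<omega> 1 (map (coord 1) \<tau>) = B mod int P"
    "hash P N \<omega> 2 (map (coord 2) \<tau>) = C mod int P"
    by (simp_all add: hash_def w A_def B_def C_def comp_def)
  have "hash P N \<omega> 0 (map (coord 0) \<tau>) \<in> int ` S" "hash P N \<omega> 1 (map (coord 1) \<tau>) \<in> int ` S"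
    "hash P N \<omega> 2 (map (coord 2) \<tau>) \<in> int ` S"
    using keep by (simp_all add: kept_def)
  then obtain x y z where xyz: "x \<in> S" "y \<in> S" "z \<in> S"
    and e: "A mod int P = int x" "B mod int P = int y" "C mod int P = int z"
    unfolding h by (metis imageE)
  have "A + B = 2 * C" using dot_triples[OF \<tau>, of u] by (simp add: A_def B_def C_def)
  moreover have "(A + B) mod int P = (int x + int y) mod int P" unfolding e[symmetric] by (simp add: mod_simps)
  moreover have "(2 * C) mod int P = (2 * int z) mod int P" unfolding e[symmetric] by (simp add: mod_simps)
  ultimately have "(int x + int y) mod int P = (2 * int z) mod int P" by simp
  moreover have "x < (P + 1) div 2" "y < (P + 1) div 2" "z < (P + 1) div 2" using xyz P by auto
  then have "2 * x < P" "2 * y < P" "2 * z < P" using P(1) by (auto elim!: oddE)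
  then have "int x + int y < int P" "2 * int z < int P" by linarith+
  ultimately have "int x + int y = 2 * int z" by simp
  then have "x + y = 2 * z" by linarith
  with P(3) xyz have "x = y" unfolding ap_free_def by blast
  with \<open>x + y = 2 * z\<close> have "z = x" by simp
  have "hash P N \<omega> i (map (coord i) \<tau>) = int x" if "i < 3" for i
  proof -
    have "i = 0 \<or> i = 1 \<or> i = 2" using that by auto
    then show ?thesis using h e \<open>x = y\<close> \<open>z = x\<close> by auto
  qed
  with xyz show ?thesis by blast
qed

text \<open>
  The linear part \<open>u\<close> and the common hash value \<open>\<sigma>\<close> may be prescribed; they determine the two shifts.
\<close>
lemma card_kept_ge:
  assumes P: "odd P" "S \<subseteq> {..<(P + 1) div 2}" and \<tau>: "\<tau> \<in> words n (triples N)"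
  shows "card S * P ^ n \<le> card {\<omega> \<in> words n {0..<int P} \<times> {0..<int P} \<times> {0..<int P}. kept P N S \<omega> \<tau>}"
proof -
  define Z where "Z = {0..<int P}"
  have Z: "finite Z" "card Z = P" by (simp_all add: Z_def)
  have P0: "P > 0" using P(1) by (auto elim: oddE)
  have "(P + 1) div 2 \<le> P" using P0 by linarith
  then have S: "\<And>\<sigma>. \<sigma> \<in> S \<Longrightarrow> \<sigma> < P"
    using P(2) by (meson lessThan_iff order_less_le_trans subsetD)
  define a b c where "a = map (coord 0) \<tau>" and "b = map (coord 1) \<tau>" and "c = map (coord 2) \<tau>"
  define U where "U u = dot u (map (\<lambda>_. N) \<tau>)" for u
  have abc: "dot u a + dot u b + dot u c = U u" for u
    unfolding a_def b_def c_def U_def using \<tau> by (intro dot_triples) (auto simp: words_def)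
  have words: "map (coord 0) \<tau> = a" "map (coord (Suc 0)) \<tau> = b" "map (coord 2) \<tau> = c"
    and U: "dot u (map (\<lambda>_. N) c) = U u" for u
    by (simp_all add: a_def b_def c_def U_def comp_def)
  define f where "f = (\<lambda>(u, \<sigma>). (u, (int \<sigma> - 2 * dot u a) mod int P, (int \<sigma> - U u + dot u c) mod int P))"
  have hash: "hash P N (f (u, \<sigma>)) i (map (coord i) \<tau>) = int \<sigma>" if "\<sigma> \<in> S" "i < 3" for u \<sigma> i
  proof -
    have eq: "2 * dot u b + 2 * (int \<sigma> - U u + dot u c) - (int \<sigma> - 2 * dot u a) = int \<sigma>"
      using abc[of u] by simp
    have "(2 * dot u b + 2 * ((int \<sigma> - U u + dot u c) mod int P) - (int \<sigma> - 2 * dot u a) mod int P) mod int P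
      = (2 * dot u b + 2 * (int \<sigma> - U u + dot u c) - (int \<sigma> - 2 * dot u a)) mod int P"
    proof -
      have "(2 * w + 2 * (x mod int P) - y mod int P) - (2 * w + 2 * x - y)
          = int P * (y div int P - 2 * (x div int P))" for w x y
        by (simp add: algebra_simps flip: minus_mult_div_eq_mod)
      then show ?thesis by (simp only: mod_eq_dvd_iff dvd_triv_left)
    qed
    also have "\<dots> = int \<sigma>" unfolding eq using S[OF that(1)] by simp
    finally have h1: "(2 * dot u b + 2 * ((int \<sigma> - U u + dot u c) mod int P) - (int \<sigma> - 2 * dot u a) mod int P) mod int P = int \<sigma>" .
    have "i = 0 \<or> i = 1 \<or> i = 2" using that by auto
    then show ?thesis
      using h1 S[OF that(1)]
      by (elim disjE) (simp_all add: hash_def f_def words U mod_simps)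
  qed
  have "card (words n Z \<times> S) \<le> card {\<omega> \<in> words n Z \<times> Z \<times> Z. kept P N S \<omega> \<tau>}"
  proof (rule card_inj_on_le[of f])
    show "inj_on f (words n Z \<times> S)"
    proof (rule inj_onI, clarify)
      fix u \<sigma> u' \<sigma>' assume S': "\<sigma> \<in> S" "\<sigma>' \<in> S" and eq: "f (u, \<sigma>) = f (u', \<sigma>')"
      have "u = u'" using eq by (simp add: f_def)
      moreover have "int \<sigma> = int \<sigma>'"
        using hash[OF S'(1), of 0 u] hash[OF S'(2), of 0 u'] eq by simp
      ultimately show "u = u' \<and> \<sigma> = \<sigma>'" by simp
    qed
    show "f ` (words n Z \<times> S) \<subseteq> {\<omega> \<in> words n Z \<times> Z \<times> Z. kept P N S \<omega> \<tau>}"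
      using hash P0 by (auto simp: kept_def) (auto simp: f_def Z_def)
  qed (use Z in \<open>auto simp: finite_words\<close>)
  then show ?thesis using Z by (simp add: card_cartesian_product card_words Z_def mult.commute)
qed

text \<open>
  If two triples sharing a word are both kept, all six hash values are equal. The linear form \<open>u\<close> must
  then make two distinct words collide, and \<open>u\<close> together with the common value determines the shifts. The
  coordinates \<open>0\<close> and \<open>2\<close> suffice for finding distinct words, because two coordinates of a triple
  determine the third.
\<close>
lemma card_both_kept_le:
  assumes P: "odd P" "S \<subseteq> {..<(P + 1) div 2}" "ap_free S"
    and cop: "\<And>d. d \<noteq> 0 \<Longrightarrow> \<bar>d\<bar> \<le> int N \<Longrightarrow> coprime d (int P)"
    and \<tau>: "\<tau> \<in> words n (triples N)" "\<tau>' \<in> words n (triples N)" "\<tau> \<noteq> \<tau>'"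
    and share: "i < 3" "map (coord i) \<tau> = map (coord i) \<tau>'"
  shows "card {\<omega> \<in> words n {0..<int P} \<times> {0..<int P} \<times> {0..<int P}. kept P N S \<omega> \<tau> \<and> kept P N S \<omega> \<tau>'} * P
    \<le> card S * P ^ n"
proof -
  define Z where "Z = {0..<int P}"
  have Z: "finite Z" "card Z = P" by (simp_all add: Z_def)
  have S: "finite S" using P(2) finite_subset by blast
  define E where "E = {\<omega> \<in> words n Z \<times> Z \<times> Z. kept P N S \<omega> \<tau> \<and> kept P N S \<omega> \<tau>'}"
  have sub: "set \<tau> \<subseteq> triples N" "set \<tau>' \<subseteq> triples N" and len: "length \<tau> = n" "length \<tau>' = n"
    using \<tau> by (auto simp: words_def)
  have common: "\<exists>\<sigma>\<in>S. \<forall>i<3. hash P N \<omega> i (map (coord i) \<tau>) = int \<sigma> \<and> hash P N \<omega> i (map (coord i) \<tau>') = int \<sigma>"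
    if "\<omega> \<in> E" for \<omega>
  proof -
    have k: "kept P N S \<omega> \<tau>" "kept P N S \<omega> \<tau>'" using that by (auto simp: E_def)
    obtain \<sigma> where 1: "\<sigma> \<in> S" "\<forall>i<3. hash P N \<omega> i (map (coord i) \<tau>) = int \<sigma>"
      using kept_common_hash[OF P sub(1) k(1)] by blast
    obtain \<sigma>' where 2: "\<sigma>' \<in> S" "\<forall>i<3. hash P N \<omega> i (map (coord i) \<tau>') = int \<sigma>'"
      using kept_common_hash[OF P sub(2) k(2)] by blast
    have "int \<sigma> = int \<sigma>'" using 1(2) 2(2) share by metis
    with 1 2 show ?thesis by auto
  qed
  obtain j where j: "j = 0 \<or> j = 2" "map (coord j) \<tau> \<noteq> map (coord j) \<tau>'"
    using triple_word_eqI[OF \<tau>(1,2), of 0 2] \<tau>(3) by auto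
  define x y where "x = map (coord j) \<tau>" and "y = map (coord j) \<tau>'"
  define B where "B = {u \<in> words n Z. int P dvd dot u x - dot u y}"
  have B: "card B * P \<le> P ^ n"
    using dot_collisions[of x y N P] j(2) cop sub len coord_le
    unfolding B_def Z_def x_def y_def by (fastforce simp: subset_iff)
  define g where "g \<omega> = (fst \<omega>, hash P N \<omega> 0 (map (coord 0) \<tau>))" for \<omega>
  have "card E \<le> card (B \<times> int ` S)"
  proof (rule card_inj_on_le[of g])
    show "finite (B \<times> int ` S)" using Z S by (simp add: B_def finite_words)
    show "inj_on g E"
    proof (rule inj_onI)
      fix \<omega> \<omega>' assume E: "\<omega> \<in> E" "\<omega>' \<in> E" and eq: "g \<omega> = g \<omega>'"
      obtain u s v where w: "\<omega> = (u, s, v)" by (cases \<omega>)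
      obtain s' v' where w': "\<omega>' = (u, s', v')" using eq w by (cases \<omega>') (auto simp: g_def)
      have in_Z: "s \<in> Z" "v \<in> Z" "s' \<in> Z" "v' \<in> Z" using E w w' by (auto simp: E_def)
      have e0: "hash P N \<omega> 0 (map (coord 0) \<tau>) = hash P N \<omega>' 0 (map (coord 0) \<tau>)"
        using eq by (simp add: g_def)
      moreover have "hash P N \<omega> 2 (map (coord 2) \<tau>) = hash P N \<omega> 0 (map (coord 0) \<tau>)"
        "hash P N \<omega>' 2 (map (coord 2) \<tau>) = hash P N \<omega>' 0 (map (coord 0) \<tau>)"
        using common[OF E(1)] common[OF E(2)] by fastforce+
      ultimately have e2: "hash P N \<omega> 2 (map (coord 2) \<tau>) = hash P N \<omega>' 2 (map (coord 2) \<tau>)" by simp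
      have "int P dvd s - s'" using e0 by (simp add: hash_def w w' mod_eq_dvd_iff)
      moreover have "int P dvd v - v'" using e2 by (simp add: hash_def w w' mod_eq_dvd_iff)
      ultimately have "s = s'" "v = v'" using in_Z unfolding Z_def by (blast intro: residue_eqI)+
      then show "\<omega> = \<omega>'" by (simp add: w w')
    qed
    show "g ` E \<subseteq> B \<times> int ` S"
    proof (rule image_subsetI)
      fix \<omega> assume E: "\<omega> \<in> E"
      obtain u s v where w: "\<omega> = (u, s, v)" by (cases \<omega>)
      obtain \<sigma> where s: "\<sigma> \<in> S" "\<forall>i<3. hash P N \<omega> i (map (coord i) \<tau>) = int \<sigma> \<and> hash P N \<omega> i (map (coord i) \<tau>') = int \<sigma>"
        using common[OF E] by blast
      have "hash P N \<omega> j x = hash P N \<omega> j y" using s(2) j(1) by (auto simp: x_def y_def)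
      then have "int P dvd dot u x - dot u y"
        using j(1)
      proof (elim disjE)
        assume "j = 0"
        with \<open>hash P N \<omega> j x = hash P N \<omega> j y\<close> have "int P dvd 2 * (dot u x - dot u y)"
          by (simp add: hash_def w mod_eq_dvd_iff right_diff_distrib)
        moreover have "coprime (int P) 2" using P(1) by simp
        ultimately show ?thesis by (metis coprime_dvd_mult_right_iff)
      next
        assume "j = 2"
        have "map (\<lambda>_. N) x = map (\<lambda>_. N) y"
          using len by (simp add: x_def y_def map_replicate_const comp_def)
        with \<open>j = 2\<close> \<open>hash P N \<omega> j x = hash P N \<omega> j y\<close> have "int P dvd dot u y - dot u x"
          by (simp add: hash_def w mod_eq_dvd_iff)
        then show ?thesis by (simp add: dvd_diff_commute)
      qed
      then show "g \<omega> \<in> B \<times> int ` S"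
        using E s by (auto simp: g_def B_def E_def w)
    qed
  qed
  then have "card E \<le> card B * card S" by (simp add: card_cartesian_product card_image)
  then have "card E * P \<le> card S * (card B * P)" by (metis mult.assoc mult.commute mult_le_mono1)
  also have "\<dots> \<le> card S * P ^ n" using B by (rule mult_le_mono2)
  finally show ?thesis by (simp add: E_def Z_def)
qed

section \<open>Collections of triple words without crossed solutions\<close>

text \<open>
  The defining property of a sum-free set with target \<open>N\<close>, for the residues modulo \<open>N + 1\<close> of the three
  coordinate words.
\<close>
definition separated :: "nat \<Rightarrow> nat \<Rightarrow> (nat \<times> nat \<times> nat) list set \<Rightarrow> bool" where
  "separated N n R \<longleftrightarrow> (\<forall>t1\<in>R. \<forall>t2\<in>R. \<forall>t3\<in>R.
    (\<forall>k<n. (coord 0 (t1 ! k) + coord 1 (t2 ! k) + coord 2 (t3 ! k)) mod (N + 1) = N)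
    \<longrightarrow> t1 = t2 \<and> t2 = t3)"

text \<open>
  A sum congruent to \<open>N\<close> modulo \<open>N + 1\<close> is at least \<open>N\<close>. As the types fix the total of all entries, which is
  \<open>n * N\<close>, equality must hold in every position.
\<close>
lemma crossed_triple_word:
  assumes t: "t1 \<in> triple_words n N M" "t2 \<in> triple_words n N M" "t3 \<in> triple_words n N M"
    and eq: "\<And>k. k < n \<Longrightarrow> (coord 0 (t1 ! k) + coord 1 (t2 ! k) + coord 2 (t3 ! k)) mod (N + 1) = N"
  obtains t where "t \<in> triple_words n N M" "map (coord 0) t = map (coord 0) t1"
    "map (coord 1) t = map (coord 1) t2" "map (coord 2) t = map (coord 2) t3"
proof -
  define t where "t = map (\<lambda>k. (coord 0 (t1 ! k), coord 1 (t2 ! k), coord 2 (t3 ! k))) [0..<n]"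
  have len: "length t1 = n" "length t2 = n" "length t3 = n" and sub: "set t1 \<subseteq> triples N"
    using t by (auto simp: triple_words_def words_def)
  have type: "mset (map (coord i) s) = M" if "i < 3" "s \<in> triple_words n N M" for i s
    using that by (auto simp: triple_words_def)
  have coords: "map (coord 0) t = map (coord 0) t1" "map (coord 1) t = map (coord 1) t2"
    "map (coord 2) t = map (coord 2) t3"
    using len by (auto simp: t_def coord_def intro!: nth_equalityI)
  have total: "(\<Sum>k<n. coord i (s ! k)) = sum_mset M" if "i < 3" "s \<in> triple_words n N M" "length s = n" for i s
  proof -
    have "sum_mset M = sum_list (map (coord i) s)"
      using type[OF that(1,2)] by (metis sum_mset_sum_list)
    then show ?thesis using that(3) by (simp add: sum_list_sum_nth atLeast0LessThan)
  qed
  have "coord 0 (t1 ! k) + coord 1 (t1 ! k) + coord 2 (t1 ! k) = N" if "k < n" for k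
    using coord_sum[of "t1 ! k" N] sub len that by (meson nth_mem subsetD)
  then have "(\<Sum>k<n. N) = (\<Sum>k<n. coord 0 (t1 ! k) + coord 1 (t1 ! k) + coord 2 (t1 ! k))"
    by simp
  also have "\<dots> = (\<Sum>k<n. coord 0 (t1 ! k) + coord 1 (t2 ! k) + coord 2 (t3 ! k))"
    using t len by (simp add: sum.distrib total)
  finally have sum: "(\<Sum>k<n. N) = (\<Sum>k<n. coord 0 (t1 ! k) + coord 1 (t2 ! k) + coord 2 (t3 ! k))" .
  have "N = coord 0 (t1 ! k) + coord 1 (t2 ! k) + coord 2 (t3 ! k)" if "k < n" for k
  proof (rule sum_mono_inv[OF sum])
    show "N \<le> coord 0 (t1 ! j) + coord 1 (t2 ! j) + coord 2 (t3 ! j)" if "j \<in> {..<n}" for j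
      using eq[of j] that by (metis lessThan_iff mod_less_eq_dividend)
  qed (use that in auto)
  then have "t \<in> words n (triples N)"
    by (auto simp: t_def words_def triples_def)
  moreover have "mset (map (coord i) t) = M" if "i < 3" for i
  proof -
    have "i = 0 \<or> i = 1 \<or> i = 2" using that by auto
    moreover have "mset (map (coord 0) t) = M" "mset (map (coord 1) t) = M" "mset (map (coord 2) t) = M"
      unfolding coords using type t by simp_all
    ultimately show ?thesis by blast
  qed
  ultimately have "t \<in> triple_words n N M" by (simp add: triple_words_def)
  with that coords show ?thesis by blast
qed

text \<open>
  A crossed solution formed from isolated kept triples is again a kept triple, because being kept is a
  condition on the three words separately. It shares a word with each of the three triples from which
  it was formed, and therefore equals all of them.
\<close>
lemma hash_selection:
  assumes P: "odd P" "S \<subseteq> {..<(P + 1) div 2}" "ap_free S"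
    and cop: "\<And>d. d \<noteq> 0 \<Longrightarrow> \<bar>d\<bar> \<le> int N \<Longrightarrow> coprime d (int P)"
    and D: "\<And>i \<tau>. i < 3 \<Longrightarrow> \<tau> \<in> triple_words n N M \<Longrightarrow>
      card {\<tau>' \<in> triple_words n N M. map (coord i) \<tau>' = map (coord i) \<tau>} = D"
  shows "\<exists>R\<subseteq>triple_words n N M. separated N n R \<and>
    real (card (triple_words n N M)) * (card S * (real P - 3 * D)) \<le> real P ^ 3 * card R"
proof -
  define \<Theta> where "\<Theta> = triple_words n N M"
  define \<Omega> where "\<Omega> = words n {0..<int P} \<times> {0..<int P} \<times> {0..<int P}"
  have P0: "P > 0" using P(1) by (auto elim: oddE)
  have fin: "finite \<Omega>" "finite \<Theta>" by (simp_all add: \<Omega>_def \<Theta>_def finite_words finite_triple_words)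
  have card\<Omega>: "card \<Omega> = P ^ (n + 2)" by (simp add: \<Omega>_def card_cartesian_product card_words power_add power2_eq_square)
  then have ne: "\<Omega> \<noteq> {}" using P0 by auto
  have word: "\<tau> \<in> words n (triples N)" if "\<tau> \<in> \<Theta>" for \<tau> using that by (simp add: \<Theta>_def triple_words_def)
  define conf where "conf t t' \<longleftrightarrow> (\<exists>i<3. map (coord i) t = map (coord i) t')" for t t'
  define R where "R \<omega> = {t \<in> \<Theta>. kept P N S \<omega> t \<and> (\<forall>t'\<in>\<Theta>. kept P N S \<omega> t' \<and> conf t t' \<longrightarrow> t' = t)}" for \<omega>
  have "\<exists>\<omega>\<in>\<Omega>. card \<Theta> * (real (card S * P ^ n) - real (3 * D) * (card S * P ^ n / P)) \<le> card \<Omega> * real (card (R \<omega>))"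
    unfolding R_def
  proof (rule exists_good_choice[OF fin(1) ne fin(2)])
    fix t assume t: "t \<in> \<Theta>"
    show "real (card S * P ^ n) \<le> real (card {\<omega> \<in> \<Omega>. kept P N S \<omega> t})"
      unfolding of_nat_le_iff \<Omega>_def by (rule card_kept_ge) (use P word[OF t] in auto)
    have "{t' \<in> \<Theta>. conf t t' \<and> t' \<noteq> t} \<subseteq> (\<Union>i<3. {t' \<in> \<Theta>. map (coord i) t' = map (coord i) t})"
      by (auto simp: conf_def)
    then have "card {t' \<in> \<Theta>. conf t t' \<and> t' \<noteq> t} \<le> card (\<Union>i<(3::nat). {t' \<in> \<Theta>. map (coord i) t' = map (coord i) t})"
      using fin by (intro card_mono) auto
    also have "\<dots> \<le> (\<Sum>i<(3::nat). card {t' \<in> \<Theta>. map (coord i) t' = map (coord i) t})"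
      by (rule card_UN_le) simp
    also have "\<dots> = (\<Sum>i<(3::nat). D)"
      using t unfolding \<Theta>_def by (intro sum.cong refl D) auto
    finally show "real (card {t' \<in> \<Theta>. conf t t' \<and> t' \<noteq> t}) \<le> real (3 * D)"
      unfolding of_nat_le_iff by simp
  next
    fix t t' assume t: "t \<in> \<Theta>" "t' \<in> \<Theta>" "conf t t'" "t' \<noteq> t"
    then obtain i where i: "i < 3" "map (coord i) t = map (coord i) t'" by (auto simp: conf_def)
    have "card {\<omega> \<in> \<Omega>. kept P N S \<omega> t \<and> kept P N S \<omega> t'} * P \<le> card S * P ^ n"
      unfolding \<Omega>_def
      by (rule card_both_kept_le[OF P cop word[OF t(1)] word[OF t(2)] t(4)[symmetric] i])
    then have "real (card {\<omega> \<in> \<Omega>. kept P N S \<omega> t \<and> kept P N S \<omega> t'}) * real P \<le> real (card S * P ^ n)"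
      by (simp only: of_nat_le_iff flip: of_nat_mult)
    then show "real (card {\<omega> \<in> \<Omega>. kept P N S \<omega> t \<and> kept P N S \<omega> t'}) \<le> real (card S * P ^ n) / real P"
      using P0 by (simp add: pos_le_divide_eq)
  qed simp
  then obtain \<omega> where w: "card \<Theta> * (real (card S * P ^ n) - real (3 * D) * (card S * P ^ n / P)) \<le> card \<Omega> * real (card (R \<omega>))"
    by blast
  have "real P ^ n * (real (card \<Theta>) * (card S * (real P - 3 * D)))
      = real P * (card \<Theta> * (real (card S * P ^ n) - real (3 * D) * (card S * P ^ n / P)))"
    using P0 by (simp add: field_simps)
  also have "\<dots> \<le> real P * (card \<Omega> * real (card (R \<omega>)))" using w by (intro mult_left_mono) auto
  also have "\<dots> = real P ^ n * (real P ^ 3 * card (R \<omega>))"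
    by (simp add: card\<Omega> power_add power2_eq_square power3_eq_cube)
  finally have bound: "real (card \<Theta>) * (card S * (real P - 3 * D)) \<le> real P ^ 3 * card (R \<omega>)"
    using P0 by (simp add: mult_le_cancel_left_pos)
  have "separated N n (R \<omega>)"
    unfolding separated_def
  proof (intro ballI impI)
    fix t1 t2 t3 assume t: "t1 \<in> R \<omega>" "t2 \<in> R \<omega>" "t3 \<in> R \<omega>"
      and eq: "\<forall>k<n. (coord 0 (t1 ! k) + coord 1 (t2 ! k) + coord 2 (t3 ! k)) mod (N + 1) = N"
    obtain t where t': "t \<in> \<Theta>" "map (coord 0) t = map (coord 0) t1"
      "map (coord 1) t = map (coord 1) t2" "map (coord 2) t = map (coord 2) t3"
      by (rule crossed_triple_word[of t1 n N M t2 t3]) (use t eq in \<open>auto simp: R_def \<Theta>_def\<close>)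
    have "kept P N S \<omega> t"
      unfolding kept_def
    proof (intro allI impI)
      fix i :: nat assume "i < 3"
      then have i: "i = 0 \<or> i = 1 \<or> i = 2" by auto
      have "hash P N \<omega> i (map (coord i) s) \<in> int ` S" if "s \<in> R \<omega>" for s
        using that \<open>i < 3\<close> by (auto simp: R_def kept_def)
      then show "hash P N \<omega> i (map (coord i) t) \<in> int ` S" using i t t' by (elim disjE) auto
    qed
    moreover have "conf t1 t" "conf t2 t" "conf t3 t"
      unfolding conf_def using t' by (metis zero_less_numeral, metis one_less_numeral_iff semiring_norm(77), metis lessI numeral_3_eq_3 numeral_2_eq_2)
    ultimately have "t = t1" "t = t2" "t = t3" using t t'(1) by (auto simp: R_def)
    then show "t1 = t2 \<and> t2 = t3" by simp
  qed
  moreover have "R \<omega> \<subseteq> \<Theta>" by (auto simp: R_def)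
  ultimately show ?thesis
    using bound unfolding \<Theta>_def[symmetric] by (intro exI[of _ "R \<omega>"] conjI) simp_all
qed

text \<open>
  The modulus is \<open>P = 12 * fact (N + 1) * D + 1\<close>: it is odd, coprime to all differences of letters, and
  between \<open>6 * D\<close> and a constant multiple of \<open>D\<close>. The lower bound makes the conflicts cost at most half of
  the kept triples. The resulting bound decreases in \<open>P\<close>, so \<open>D\<close> may be replaced by \<open>W\<close> in the Behrend
  factor.
\<close>
lemma large_separated_set:
  assumes c: "c > 0" and beh: "\<And>m::nat. m \<ge> 1 \<Longrightarrow> \<exists>S\<subseteq>{..<m}. ap_free S \<and>
      c * real m * exp (- 2 * sqrt (2 * ln 2 * ln (real m))) / (sqrt (ln (real m)) + 1) \<le> real (card S)"
    and ne: "triple_words n N M \<noteq> {}"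
  defines "W \<equiv> card (permutations_of_multiset M)"
  shows "\<exists>R\<subseteq>triple_words n N M. separated N n R \<and>
    c * W / (52 * fact (N + 1)) * (exp (- 2 * sqrt (2 * ln 2 * ln (7 * fact (N + 1) * real W)))
      / (sqrt (ln (7 * fact (N + 1) * real W)) + 1)) \<le> card R"
proof -
  obtain D where D: "card (triple_words n N M) = W * D" "1 \<le> D" "D \<le> W"
    "\<And>i \<tau>. i < 3 \<Longrightarrow> \<tau> \<in> triple_words n N M \<Longrightarrow>
      card {\<tau>' \<in> triple_words n N M. map (coord i) \<tau>' = map (coord i) \<tau>} = D"
    using common_fibre_card[OF ne] unfolding W_def by blast
  define f :: nat where "f = fact (N + 1)"
  have f: "f \<ge> 1" unfolding f_def by (rule fact_ge_1)
  define P where "P = 12 * f * D + 1"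
  have Peq: "P = 12 * (f * D) + 1" by (simp add: P_def mult.assoc)
  have half: "(P + 1) div 2 = 6 * (f * D) + 1" unfolding Peq by simp
  have fD: "D \<le> f * D" "1 \<le> f * D" using f D(2) by simp_all
  have "odd P" unfolding Peq by simp
  moreover have "6 * D \<le> P" "P \<le> 13 * (f * D)" using fD unfolding Peq by linarith+
  ultimately have P: "odd P" "6 * D \<le> P" "P \<le> 13 * (f * D)" by blast+
  have cop: "coprime d (int P)" if "d \<noteq> 0" "\<bar>d\<bar> \<le> int N" for d
  proof -
    have "nat \<bar>d\<bar> dvd f" unfolding f_def using that by (intro dvd_fact) auto
    then have "d dvd int f" by (metis int_dvd_int_iff dvd_abs_iff abs_dvd_iff int_nat_eq abs_ge_zero nat_0_le)
    then have d: "d dvd 12 * int f * int D" by simp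
    show ?thesis
    proof (rule coprimeI)
      fix e assume e: "e dvd d" "e dvd int P"
      have "int P = 12 * int f * int D + 1" by (simp add: P_def)
      then show "is_unit e" using e d by (metis dvd_add_right_iff dvd_trans)
    qed
  qed
  define G where "G x = exp (- 2 * sqrt (2 * ln 2 * ln x)) / (sqrt (ln x) + 1)" for x :: real
  define m where "m = (P + 1) div 2"
  have m: "m \<ge> 1" "m \<le> 7 * (f * D)" "P \<le> 2 * m"
    using fD unfolding m_def half Peq by linarith+
  obtain S where S: "S \<subseteq> {..<m}" "ap_free S" "c * real m * G (real m) \<le> real (card S)"
    using beh[OF m(1)] unfolding G_def by auto
  obtain R where R: "R \<subseteq> triple_words n N M" "separated N n R"
    "real (card (triple_words n N M)) * (card S * (real P - 3 * D)) \<le> real P ^ 3 * card R"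
    using hash_selection[OF P(1) S(1)[unfolded m_def] S(2) cop D(4)] by auto
  have anti: "G y \<le> G x" if "1 \<le> x" "x \<le> y" for x y
    unfolding G_def using that by (intro frac_le) (auto intro!: add_nonneg_pos)
  have "m \<le> 7 * (f * W)" using m(2) D(3) by (meson mult_le_mono2 order_trans)
  then have "real m \<le> real (7 * (f * W))" by (simp only: of_nat_le_iff)
  then have "real m \<le> 7 * f * real W" by simp
  then have G: "G (7 * f * real W) \<le> G (real m)" using m(1) by (intro anti) auto
  have G0: "0 \<le> G (7 * f * real W)"
  proof -
    have "1 \<le> f * W" using f D(2,3) by simp
    then have "real 1 \<le> real (f * W)" by (simp only: of_nat_le_iff)
    then have "1 \<le> 7 * f * real W" by simp
    then show ?thesis unfolding G_def by (intro divide_nonneg_nonneg add_nonneg_nonneg) auto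
  qed
  have P0: "real P > 0" unfolding of_nat_0_less_iff by (simp add: P_def)
  have "real W * D * (c * (P / 2) * G (7 * f * real W)) * (P / 2) \<le> real W * D * card S * (real P - 3 * D)"
  proof (rule mult_mono)
    have "c * (P / 2) * G (7 * f * real W) \<le> c * m * G m"
      using c m G G0 by (intro mult_mono) auto
    then show "real W * D * (c * (P / 2) * G (7 * f * real W)) \<le> real W * D * card S"
      using S(3) by (intro mult_left_mono) auto
    show "real P / 2 \<le> real P - 3 * D" using P(2) by linarith
  qed (use P0 in auto)
  also have "\<dots> \<le> real P ^ 3 * card R" using R(3) D(1) by (simp add: mult.assoc)
  finally have "real W * D * c * G (7 * f * real W) \<le> 4 * real P * card R"
    using P0 by (simp add: power3_eq_cube field_simps)
  also have "\<dots> \<le> 4 * real (13 * (f * D)) * card R"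
  proof (intro mult_right_mono mult_left_mono)
    show "real P \<le> real (13 * (f * D))" using P(3) by (simp only: of_nat_le_iff)
  qed simp_all
  finally have "D * (c * W * G (7 * f * real W)) \<le> D * (52 * real f * card R)" by (simp add: mult_ac)
  then have "c * W * G (7 * f * real W) \<le> 52 * real f * card R"
    using D(2) by (simp add: mult_le_cancel_left_pos)
  then have "c * W / (52 * f) * G (7 * f * real W) \<le> card R"
    using f by (simp add: field_simps)
  moreover have "real f = fact (N + 1)" unfolding f_def by (rule of_nat_fact)
  ultimately show ?thesis using R(1,2) unfolding G_def by auto
qed

section \<open>Sum-free sets in powers of a cyclic group\<close>

text \<open>
  Words shorter than \<open>n\<close> are padded with zeros, also in the target.
\<close>
lemma separated_imp_sum_free_set:
  assumes R: "R \<subseteq> words n0 (triples N)" "separated N n0 R" and n: "n0 \<le> n"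
  shows "\<exists>(t :: nat \<Rightarrow> int) (I :: nat set) a b c.
    sum_free_set (integer_mod_group (N + 1)) n t I a b c \<and> card I = card R"
proof -
  have fin: "finite R" using R(1) finite_words finite_triples finite_subset by blast
  obtain e where e: "bij_betw e {0..<card R} R" using ex_bij_betw_nat_finite[OF fin] by blast
  define x where "x i j = (\<lambda>k\<in>{..<n}. if k < n0 then int (coord i (e j ! k)) else 0)" for i j
  define t where "t = (\<lambda>k\<in>{..<n}. if k < n0 then int N else 0)"
  have eR: "e j \<in> R" if "j \<in> {0..<card R}" for j using e that by (auto simp: bij_betw_def)
  have trip: "e j ! k \<in> triples N" if "j \<in> {0..<card R}" "k < n0" for j k
    using eR[OF that(1)] R(1) that(2) by (auto simp: words_def subset_iff simp del: split_paired_All)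
  have carr: "x i j \<in> carrier (power_group (integer_mod_group (N + 1)) n)" if "j \<in> {0..<card R}" for i j
    unfolding carrier_product_group
  proof (rule PiE_I)
    fix k assume "k \<in> {..<n}"
    then show "x i j k \<in> carrier (integer_mod_group (N + 1))"
      using coord_le[OF trip[OF that], of k i] by (auto simp: x_def carrier_integer_mod_group)
  qed (simp add: x_def)
  have iff: "x 0 i \<otimes>\<^bsub>power_group (integer_mod_group (N + 1)) n\<^esub> x 1 j
        \<otimes>\<^bsub>power_group (integer_mod_group (N + 1)) n\<^esub> x 2 k = t \<longleftrightarrow> i = j \<and> j = k"
    if ijk: "i \<in> {0..<card R}" "j \<in> {0..<card R}" "k \<in> {0..<card R}" for i j k
  proof -
    have sum: "x 0 i \<otimes>\<^bsub>power_group (integer_mod_group (N + 1)) n\<^esub> x 1 j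
        \<otimes>\<^bsub>power_group (integer_mod_group (N + 1)) n\<^esub> x 2 k
      = (\<lambda>l\<in>{..<n}. if l < n0 then int ((coord 0 (e i ! l) + coord 1 (e j ! l) + coord 2 (e k ! l)) mod (N + 1)) else 0)"
      (is "_ = ?l") by (auto simp: x_def restrict_def mod_simps zmod_int)
    have sol: "?l = t \<longleftrightarrow> (\<forall>l<n0. (coord 0 (e i ! l) + coord 1 (e j ! l) + coord 2 (e k ! l)) mod (N + 1) = N)"
      (is "_ \<longleftrightarrow> ?r")
    proof
      assume "?l = t"
      then have eq: "?l l = t l" for l by simp
      show ?r
      proof (intro allI impI)
        fix l assume "l < n0"
        with eq[of l] n show "(coord 0 (e i ! l) + coord 1 (e j ! l) + coord 2 (e k ! l)) mod (N + 1) = N"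
          by (simp add: t_def)
      qed
    next
      assume ?r
      then show "?l = t" by (auto simp: t_def restrict_def)
    qed
    have sep: "?r \<longleftrightarrow> e i = e j \<and> e j = e k"
    proof
      assume "\<forall>l<n0. (coord 0 (e i ! l) + coord 1 (e j ! l) + coord 2 (e k ! l)) mod (N + 1) = N"
      then show "e i = e j \<and> e j = e k"
        using R(2)[unfolded separated_def, rule_format, OF eR[OF ijk(1)] eR[OF ijk(2)] eR[OF ijk(3)]]
        by simp
    next
      assume "e i = e j \<and> e j = e k"
      then show "\<forall>l<n0. (coord 0 (e i ! l) + coord 1 (e j ! l) + coord 2 (e k ! l)) mod (N + 1) = N"
        using coord_sum[OF trip[OF ijk(3)]] by simp
    qed
    have "e i = e j \<and> e j = e k \<longleftrightarrow> i = j \<and> j = k"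
      using inj_on_eq_iff[OF bij_betw_imp_inj_on[OF e] ijk(1,2)]
        inj_on_eq_iff[OF bij_betw_imp_inj_on[OF e] ijk(2,3)] by simp
    then show ?thesis by (simp only: sum sol sep)
  qed
  have "t \<in> carrier (power_group (integer_mod_group (N + 1)) n)"
    by (auto simp: t_def carrier_integer_mod_group)
  moreover have "comm_group (integer_mod_group (N + 1))" "finite (carrier (integer_mod_group (N + 1)))"
    by (simp_all add: carrier_integer_mod_group)
  ultimately have "sum_free_set (integer_mod_group (N + 1)) n t {0..<card R} (x 0) (x 1) (x 2)"
    unfolding sum_free_set_def by (intro conjI ballI carr iff finite_atLeastLessThan)
  moreover have "card {0..<card R} = card R" by simp
  ultimately show ?thesis
    by (intro exI[of _ t] exI[of _ "{0..<card R}"] exI[of _ "x 0"] exI[of _ "x 1"] exI[of _ "x 2"] conjI)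
qed

theorem theorem2:
  fixes q :: nat
  assumes "q \<ge> 2"
  shows "\<exists>(K::real) (N::nat). \<forall>n\<ge>N.
    \<exists>(t :: nat \<Rightarrow> int) (I :: nat set) (a :: nat \<Rightarrow> nat \<Rightarrow> int) (b :: nat \<Rightarrow> nat \<Rightarrow> int) (c :: nat \<Rightarrow> nat \<Rightarrow> int).
      sum_free_set (integer_mod_group q) n t I a b c \<and>
      real (card I) \<ge> theta q ^ n *
        exp (- 2 * sqrt ((2 * ln 2 * ln (theta q)) * real n) - K * ln (real n))"
proof -
  obtain c where c: "c > 0" and beh: "\<And>m::nat. m \<ge> 1 \<Longrightarrow> \<exists>S\<subseteq>{..<m}. ap_free S \<and>
      c * real m * exp (- 2 * sqrt (2 * ln 2 * ln (real m))) / (sqrt (ln (real m)) + 1) \<le> real (card S)"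
    using behrend by auto
  define f :: real where "f = fact q"
  define \<theta> where "\<theta> = theta q"
  have f: "f \<ge> 1" by (simp add: f_def)
  have th: "\<theta> \<ge> 1" using theta_ge_1[OF assms] by (simp add: \<theta>_def)
  then have lt: "ln \<theta> \<ge> 0" by simp
  define A where "A = ln (7 * f)"
  have A: "A \<ge> 0" using f by (simp add: A_def)
  \<comment> \<open>\<open>C\<close> collects the constant factors; the power of \<open>n\<close> that is lost
    consists of \<open>3 * q\<close> from the number of types, \<open>1\<close> from \<open>sqrt (ln P)\<close>, and
    \<open>1\<close> for absorbing \<open>C\<close>\<close>
  define C where "C = c / (52 * f * \<theta>\<^sup>2 * 64) * (exp (- 2 * sqrt (2 * ln 2 * A)) / (A + ln \<theta> + 2))"
  have "0 < A + ln \<theta> + 2" using A lt by linarith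
  then have C: "C > 0" using c f th unfolding C_def by (intro mult_pos_pos divide_pos_pos) auto
  have main: "\<exists>t (I :: nat set) a b c. sum_free_set (integer_mod_group q) n t I a b c \<and>
      \<theta> ^ n * exp (- 2 * sqrt ((2 * ln 2 * ln \<theta>) * real n) - real (3 * q + 2) * ln (real n)) \<le> real (card I)"
    if n: "n \<ge> max 2 (nat \<lceil>1 / C\<rceil>)" for n
  proof -
    have n2: "n \<ge> 2" and nC: "1 / C \<le> n" using n by (auto simp: le_nat_iff ceiling_le_iff) 
    \<comment> \<open>symmetric types exist for lengths divisible by three; at most two positions are padded\<close>
    define m where "m = n div 3"
    have m: "3 * m \<le> n" "n \<le> 3 * m + 2" "m + 1 \<le> n" using n2 by (auto simp: m_def)
    obtain M where M: "\<exists>\<tau>\<in>words (3 * m) (triples (q - 1)). \<forall>i<3. mset (map (coord i) \<tau>) = M"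
      "real (card (permutations_of_multiset M)) \<le> \<theta> ^ (3 * m)"
      "\<theta> ^ (3 * m) \<le> real (card (permutations_of_multiset M)) * (4 * (real m + 1) ^ q) ^ 3"
      using exists_heavy_symmetric_type[OF assms, of m] unfolding \<theta>_def by blast
    define W where "W = real (card (permutations_of_multiset M))"
    have "triple_words (3 * m) (q - 1) M \<noteq> {}" using M(1) by (auto simp: triple_words_def)
    from large_separated_set[OF c beh this] obtain R where R: "R \<subseteq> triple_words (3 * m) (q - 1) M"
      "separated (q - 1) (3 * m) R"
      "c * W / (52 * f) * (exp (- 2 * sqrt (2 * ln 2 * ln (7 * f * W))) / (sqrt (ln (7 * f * W)) + 1)) \<le> card R"
      using assms unfolding W_def f_def by auto
    have "R \<subseteq> words (3 * m) (triples (q - 1))" using R(1) by (auto simp: triple_words_def)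
    from separated_imp_sum_free_set[OF this R(2) m(1)] assms obtain t a b c' and I :: "nat set"
      where sf: "sum_free_set (integer_mod_group q) n t I a b c'" "card I = card R" by auto
    have W0: "W > 0"
    proof (rule ccontr)
      assume "\<not> W > 0"
      then have "\<theta> ^ (3 * m) \<le> 0" using M(3) by (simp add: W_def)
      with th show False by (meson less_le_trans not_le zero_less_one zero_less_power)
    qed
    then have W1: "W \<ge> 1" by (simp add: W_def)
    have Wn: "W \<le> \<theta> ^ n"
      using M(2) power_increasing[OF m(1) th] by (simp add: W_def)
    have lnW: "ln (7 * f * W) \<le> A + n * ln \<theta>"
    proof -
      have "ln (7 * f * W) \<le> ln (7 * f * \<theta> ^ n)" using f W0 Wn by (subst ln_le_cancel_iff) auto
      also have "\<dots> = A + n * ln \<theta>" using f th by (simp add: A_def ln_mult ln_realpow)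
      finally show ?thesis .
    qed
    have lnW0: "0 \<le> ln (7 * f * W)"
    proof -
      have "1 * 1 \<le> (7 * f) * W" using f W1 by (intro mult_mono) auto
      then show ?thesis by simp
    qed
    have e1: "exp (- 2 * sqrt (2 * ln 2 * A)) * exp (- 2 * sqrt ((2 * ln 2 * ln \<theta>) * real n))
        \<le> exp (- 2 * sqrt (2 * ln 2 * ln (7 * f * W)))"
    proof -
      have "sqrt (2 * ln 2 * ln (7 * f * W)) \<le> sqrt (2 * ln 2 * (A + n * ln \<theta>))"
        using lnW by simp
      also have "\<dots> = sqrt (2 * ln 2 * A + 2 * ln 2 * ln \<theta> * n)" by (simp add: algebra_simps)
      also have "\<dots> \<le> sqrt (2 * ln 2 * A) + sqrt (2 * ln 2 * ln \<theta> * n)"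
        using A lt by (intro sqrt_add_le_add_sqrt) auto
      finally show ?thesis by (simp flip: exp_add)
    qed
    have e2: "sqrt (ln (7 * f * W)) + 1 \<le> (A + ln \<theta> + 2) * n"
    proof -
      have "sqrt y \<le> y + 1" if "y \<ge> 0" for y :: real
        using that by (intro real_le_lsqrt) (auto simp: power2_eq_square algebra_simps)
      then have "sqrt (ln (7 * f * W)) + 1 \<le> A + n * ln \<theta> + 2" using lnW0 lnW by force
      also have "\<dots> \<le> A * n + n * ln \<theta> + 2 * n"
        using A n2 mult_left_mono[of 1 "real n" A] by simp
      finally show ?thesis by (simp add: algebra_simps)
    qed
    have e3: "\<theta> ^ n / \<theta>\<^sup>2 \<le> W * (64 * real n ^ (3 * q))"
    proof -
      have "\<theta> ^ n \<le> \<theta> ^ (3 * m + 2)" using m th by (intro power_increasing) auto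
      then have "\<theta> ^ n / \<theta>\<^sup>2 \<le> \<theta> ^ (3 * m)" using th by (simp add: power_add power2_eq_square field_simps)
      also have "\<dots> \<le> W * (4 * (real m + 1) ^ q) ^ 3" using M(3) by (simp add: W_def)
      also have "\<dots> \<le> W * (4 * real n ^ q) ^ 3"
        using W0 m(3) by (intro mult_left_mono power_mono) auto
      also have "(4 * real n ^ q) ^ 3 = 64 * real n ^ (3 * q)"
        by (simp add: power_mult_distrib mult.commute flip: power_mult)
      finally show ?thesis .
    qed
    define E where "E = exp (- 2 * sqrt ((2 * ln 2 * ln \<theta>) * real n))"
    define X where "X = exp (- 2 * sqrt (2 * ln 2 * A))"
    define B where "B = A + ln \<theta> + 2"
    have B: "B > 0" using A lt unfolding B_def by linarith
    have n0: "real n > 0" using n2 by simp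
    have "\<theta> ^ n * E * C / n ^ (3 * q + 1) = c / (52 * f) * (\<theta> ^ n / \<theta>\<^sup>2 / (64 * real n ^ (3 * q))) * (X * E / (B * n))"
      unfolding C_def X_def[symmetric] B_def[symmetric] by (simp add: field_simps)
    also have "\<dots> \<le> c / (52 * f) * W * (exp (- 2 * sqrt (2 * ln 2 * ln (7 * f * W))) / (sqrt (ln (7 * f * W)) + 1))"
    proof (intro mult_mono mult_left_mono frac_le)
      show "\<theta> ^ n / \<theta>\<^sup>2 / (64 * real n ^ (3 * q)) \<le> W"
        using e3 n0 by (subst pos_divide_le_eq) simp_all
      show "X * E \<le> exp (- 2 * sqrt (2 * ln 2 * ln (7 * f * W)))" using e1 by (simp only: X_def E_def)
      show "sqrt (ln (7 * f * W)) + 1 \<le> B * n" using e2 by (simp only: B_def)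
      show "0 < sqrt (ln (7 * f * W)) + 1" using lnW0 by (simp add: add_nonneg_pos)
    qed (use c f th W0 B n0 in \<open>auto simp: X_def E_def\<close>)
    also have "\<dots> \<le> card R" using R(3) by simp
    finally have low: "\<theta> ^ n * E * C / n ^ (3 * q + 1) \<le> card R" .
    have "\<theta> ^ n * exp (- 2 * sqrt ((2 * ln 2 * ln \<theta>) * real n) - real (3 * q + 2) * ln (real n))
        = \<theta> ^ n * E * (1 / n ^ (3 * q + 2))"
    proof -
      have "exp (real (3 * q + 2) * ln (real n)) = real n ^ (3 * q + 2)"
        using n0 by (simp only: exp_of_nat_mult exp_ln)
      then show ?thesis by (simp add: E_def exp_diff)
    qed
    also have "\<dots> = \<theta> ^ n * E * (1 / n) / n ^ (3 * q + 1)" by simp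
    also have "\<dots> \<le> \<theta> ^ n * E * C / n ^ (3 * q + 1)"
    proof (intro divide_right_mono mult_left_mono)
      show "1 / real n \<le> C" using nC n0 C by (simp add: field_simps)
    qed (use th in \<open>auto simp: E_def\<close>)
    also note low
    finally show ?thesis using sf by (intro exI[of _ t] exI[of _ I] exI[of _ a] exI[of _ b] exI[of _ c']) auto
  qed
  show ?thesis
    by (intro exI[of _ "real (3 * q + 2)"] exI[of _ "max 2 (nat \<lceil>1 / C\<rceil>)"] allI impI)
       (use main in \<open>simp only: \<theta>_def\<close>)
qed

end
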